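(* Consider a project (as defined in the context) satisfying the following three conditions: (PCLI1) $g(x,z)>0$ for every $x\in\mathsf X$ and $z\in\overline{\mathbb R}$; (PCLI2) the MP index $m(x)= f(x,x)/g(x,x)$ is nondecreasing and continuous on $\mathsf X$; (PCLI3) for every $x\in\mathsf X$ and all $-\infty<z_1<z_2<\infty$, $F(x,z_2)-F(x,z_1)=\int_{(z_1,z_2]} m(z)\,G(x,dz)$. Then the project is threshold-indexable (i.e., both thresholdable and indexable) with Whittle index $m(\cdot)$, and its optimal threshold maps are precisely the generalized inverses $\zeta(\cdot)$ of $m(\cdot)$.
   Context: Project model. $\mathsf X=\{x\in\mathbb R:\ell\le x\le u\}$ with $-\infty\le\ell<u\le\infty$; all sets and functions are Borel measurable. A project has state $X_t\in\mathsf X$ and action $A_t\in\{0,1\}$ ($1$ = active, $0$ = passive) at times $t=0,1,\dots$. When $(X_t,A_t)=(x,a)$ it yields reward $r(x,a)$, consumes $c(x,a)$ units of a resource, and $X_{t+1}\sim\kappa^a(x,\cdot)$, with $\kappa^0,\kappa^1$ Markov transition kernels on $\mathsf X$. The discount factor is $\beta\in[0,1)$. Standing assumption: for each $a\in\{0,1\}$, $r(\cdot,a)$ and $c(\cdot,a)$ are continuous on $\mathsf X$, $0\le c(x,0)<c(x,1)$ for all $x$, and there are a function $w:\mathsf X\to[1,\infty)$ and constants $M>0$, $\beta\le\gamma<1$ with $\max\{|r(x,a)|,c(x,a)\}\le M w(x)$ and $\beta\int w(y)\,\kappa^a(x,dy)\le\gamma w(x)$ for all $x,a$. Policies and metrics.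 $\Pi$ is the class of nonanticipative (history-dependent, possibly randomized) policies. $F(x,\pi)=\mathsf E_x^\pi[\sum_{t\ge0}\beta^t r(X_t,A_t)]$, $G(x,\pi)=\mathsf E_x^\pi[\sum_{t\ge0}\beta^t c(X_t,A_t)]$, where $X_0=x$. For $\lambda\in\mathbb R$, $V_\lambda(x,\pi)=F(x,\pi)-\lambda G(x,\pi)$ and $V^*_\lambda(x)=\sup_{\pi\in\Pi}V_\lambda(x,\pi)$. For $z\in\overline{\mathbb R}=\mathbb R\cup\{-\infty,\infty\}$ the $z$-policy takes $A_t=1$ iff $X_t>z$; its metrics are $F(x,z),G(x,z)$. For an action $a$ and a policy $\pi$, $\langle a,\pi\rangle$ takes action $a$ at time $0$ and follows $\pi$ afterwards. Marginal metrics: $f(x,\pi)=F(x,\langle1,\pi\rangle)-F(x,\langle0,\pi\rangle)$, $g(x,\pi)=G(x,\langle1,\pi\rangle)-G(x,\langle0,\pi\rangle)$; $f(x,z),g(x,z)$ are these for the $z$-policy. The integral in (PCLI3) is a Lebesgue–Stieltjes integral with respect to $z\mapsto G(x,z)$ on $\mathbb R$ (the interval $(a,b]$ has mass $G(x,b)-G(x,a)$). Under (PCLI1)–(PCLI2), $m$ is extended to $\overline{\mathbb R}$ by $m(z)=m(\ell)$ for $z<\ell$ if $\ell>-\infty$, $m(z)=m(u)$ for $z>u$ if $u<\infty$, $m(-\infty)=\lim_{z\to-\infty}m(z)$, $m(\infty)=\lim_{z\to\infty}m(z)$. Indexability and thresholdability. Let $V_\lambda^{\langle a,*\rangle}(x)=r(x,a)-\lambda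 c(x,a)+\beta\int V_\lambda^*(y)\,\kappa^a(x,dy)$ and $\Delta_\lambda(x)=V_\lambda^{\langle1,*\rangle}(x)-V_\lambda^{\langle0,*\rangle}(x)$. The project is indexable with Whittle index $\lambda^*:\mathsf X\to\mathbb R$ if $\operatorname{sgn}\Delta_\lambda(x)=\operatorname{sgn}(\lambda^*(x)-\lambda)$ for all $x\in\mathsf X$, $\lambda\in\mathbb R$, where $\operatorname{sgn}\in\{-1,0,1\}$. It is thresholdable if there is a map $z^*:\mathbb R\to\overline{\mathbb R}$ (called an optimal threshold map) such that for all $x\in\mathsf X$, $\lambda\in\mathbb R$: $x\le z^*(\lambda)$ implies $\Delta_\lambda(x)\le0$, and $x\ge z^*(\lambda)$ implies $\Delta_\lambda(x)\ge0$. Generalized inverses. For $\lambda\in\mathbb R$ let $\mathsf Z_\lambda$ be: $\{z\in\overline{\mathbb R}:m(z)=\lambda\}$ if $m(x)=\lambda$ for some $x\in\mathsf X$; if $\lambda<m(x)$ for all $x\in\mathsf X$, $\{z\in\overline{\mathbb R}:z<\ell\}$ when $\ell>-\infty$ and $\{-\infty\}$ when $\ell=-\infty$; if $\lambda>m(x)$ for all $x\in\mathsf X$, $\{z\in\overline{\mathbb R}:z>u\}$ when $u<\infty$ and $\{\infty\}$ when $u=\infty$. A map $\zeta:\mathbb R\to\overline{\mathbb R}$ is a generalized inverse of $m$ if $\zeta(\lambda)\in\mathsf Z_\lambda$ for all $\lambda\in\mathbb R$. *)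

theory Defs
  imports "HOL-Probability.Probability"
begin

text \<open>
  The actions are the Booleans, \<^term>\<open>True\<close> being the active action 1 and \<^term>\<open>False\<close> the
  passive action 0.
\<close>

record project =
  lower_end :: ereal
  upper_end :: ereal
  discount :: real
  reward :: "real \<Rightarrow> bool \<Rightarrow> real"
  consumption :: "real \<Rightarrow> bool \<Rightarrow> real"
  kernel :: "bool \<Rightarrow> real \<Rightarrow> real measure"

definition states :: "project \<Rightarrow> real set" where
  "states P = {x. lower_end P \<le> ereal x \<and> ereal x \<le> upper_end P}"

definition state_space :: "project \<Rightarrow> real measure" where
  "state_space P = restrict_space borel (states P)"

text \<open>
  The weight condition is stated with the nonnegative integral, so that it cannot hold for
  \<open>\<beta> > 0\<close> because of a non-integrable weight.
\<close>

definition valid_project :: "project \<Rightarrow> bool" where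
  "valid_project P \<longleftrightarrow>
     lower_end P < upper_end P \<and> 0 \<le> discount P \<and> discount P < 1 \<and>
     (\<forall>a. kernel P a \<in> state_space P \<rightarrow>\<^sub>M prob_algebra (state_space P)) \<and>
     (\<forall>a. continuous_on (states P) (\<lambda>x. reward P x a)) \<and>
     (\<forall>a. continuous_on (states P) (\<lambda>x. consumption P x a)) \<and>
     (\<forall>x\<in>states P. 0 \<le> consumption P x False \<and> consumption P x False < consumption P x True) \<and>
     (\<exists>w M \<gamma>. w \<in> borel_measurable (state_space P) \<and> (\<forall>x\<in>states P. 1 \<le> w x) \<and>
        0 < M \<and> discount P \<le> \<gamma> \<and> \<gamma> < 1 \<and>
        (\<forall>x\<in>states P. \<forall>a. max \<bar>reward P x a\<bar> (consumption P x a) \<le> M * w x \<and>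
           ennreal (discount P) * (\<integral>\<^sup>+ y. ennreal (w y) \<partial>kernel P a x) \<le> ennreal (\<gamma> * w x)))"


section \<open>Policies and the controlled process\<close>

type_synonym trajectory = "nat \<Rightarrow> real \<times> bool"

text \<open>
  \<open>\<pi> t h x\<close> is the probability of the active action at time \<open>t\<close> when the current state is \<open>x\<close> and
  \<open>h\<close> lists the states and actions at the times \<open>0, \<dots>, t - 1\<close>.
\<close>

type_synonym policy = "nat \<Rightarrow> trajectory \<Rightarrow> real \<Rightarrow> real"

definition stage_space :: "project \<Rightarrow> (real \<times> bool) measure" where
  "stage_space P = state_space P \<Otimes>\<^sub>M count_space UNIV"

definition history_space :: "project \<Rightarrow> nat \<Rightarrow> trajectory measure" where
  "history_space P t = PiM {0..<t} (\<lambda>_. stage_space P)"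

definition policies :: "project \<Rightarrow> policy set" where
  "policies P = {\<pi>. \<forall>t.
     (\<lambda>(h, x). \<pi> t h x) \<in> borel_measurable (history_space P t \<Otimes>\<^sub>M state_space P) \<and>
     (\<forall>h\<in>space (history_space P t). \<forall>x\<in>states P. 0 \<le> \<pi> t h x \<and> \<pi> t h x \<le> 1)}"

definition state_law :: "project \<Rightarrow> real \<Rightarrow> nat \<Rightarrow> trajectory \<Rightarrow> real measure" where
  "state_law P x t h =
     (case t of 0 \<Rightarrow> return (state_space P) x | Suc s \<Rightarrow> kernel P (snd (h s)) (fst (h s)))"

definition stage_law ::
  "project \<Rightarrow> policy \<Rightarrow> real \<Rightarrow> nat \<Rightarrow> trajectory \<Rightarrow> (real \<times> bool) measure" where
  "stage_law P \<pi> x t h = state_law P x t h \<bind>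
     (\<lambda>y. distr (measure_pmf (bernoulli_pmf (\<pi> t h y))) (stage_space P) (Pair y))"

text \<open>The Ionescu-Tulcea measure on infinite trajectories, with expectation \<open>E\<^sub>x\<^sup>\<pi>\<close>.\<close>

definition trajectory_law :: "project \<Rightarrow> policy \<Rightarrow> real \<Rightarrow> trajectory measure" where
  "trajectory_law P \<pi> x =
     projective_family.lim UNIV
       (Ionescu_Tulcea.CI (stage_law P \<pi> x) (\<lambda>_. stage_space P)) (\<lambda>_. stage_space P)"

definition reward_metric :: "project \<Rightarrow> real \<Rightarrow> policy \<Rightarrow> real" where
  "reward_metric P x \<pi> =
     (\<integral>\<omega>. (\<Sum>t. discount P ^ t * reward P (fst (\<omega> t)) (snd (\<omega> t))) \<partial>trajectory_law P \<pi> x)"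

definition resource_metric :: "project \<Rightarrow> real \<Rightarrow> policy \<Rightarrow> real" where
  "resource_metric P x \<pi> =
     (\<integral>\<omega>. (\<Sum>t. discount P ^ t * consumption P (fst (\<omega> t)) (snd (\<omega> t))) \<partial>trajectory_law P \<pi> x)"

definition policy_value :: "project \<Rightarrow> real \<Rightarrow> real \<Rightarrow> policy \<Rightarrow> real" where
  "policy_value P lam x \<pi> = reward_metric P x \<pi> - lam * resource_metric P x \<pi>"

definition optimal_value :: "project \<Rightarrow> real \<Rightarrow> real \<Rightarrow> real" where
  "optimal_value P lam x = (SUP \<pi>\<in>policies P. policy_value P lam x \<pi>)"


section \<open>Threshold policies and marginal metrics\<close>

definition threshold_policy :: "ereal \<Rightarrow> policy" where
  "threshold_policy z = (\<lambda>t h x. if z < ereal x then 1 else 0)"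

text \<open>After time 0, \<open>\<pi>\<close> is applied to the history with its first entry removed.\<close>

definition act_then :: "bool \<Rightarrow> policy \<Rightarrow> policy" where
  "act_then a \<pi> = (\<lambda>t h x. case t of 0 \<Rightarrow> of_bool a
                                   | Suc s \<Rightarrow> \<pi> s (\<lambda>i\<in>{0..<s}. h (Suc i)) x)"

definition marginal_reward :: "project \<Rightarrow> real \<Rightarrow> policy \<Rightarrow> real" where
  "marginal_reward P x \<pi> =
     reward_metric P x (act_then True \<pi>) - reward_metric P x (act_then False \<pi>)"

definition marginal_resource :: "project \<Rightarrow> real \<Rightarrow> policy \<Rightarrow> real" where
  "marginal_resource P x \<pi> =
     resource_metric P x (act_then True \<pi>) - resource_metric P x (act_then False \<pi>)"

definition mp_index :: "project \<Rightarrow> real \<Rightarrow> real" where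
  "mp_index P x = marginal_reward P x (threshold_policy (ereal x)) /
                  marginal_resource P x (threshold_policy (ereal x))"

definition mp_index_real :: "project \<Rightarrow> real \<Rightarrow> real" where
  "mp_index_real P z =
     (if ereal z < lower_end P then mp_index P (real_of_ereal (lower_end P))
      else if upper_end P < ereal z then mp_index P (real_of_ereal (upper_end P))
      else mp_index P z)"


text \<open>The limits at \<open>\<plusminus>\<infinity>\<close> may be infinite.\<close>

definition mp_index_ext :: "project \<Rightarrow> ereal \<Rightarrow> ereal" where
  "mp_index_ext P z = (case z of
       ereal y \<Rightarrow> ereal (mp_index_real P y)
     | PInfty \<Rightarrow> Lim at_top (\<lambda>y. ereal (mp_index_real P y))
     | MInfty \<Rightarrow> Lim at_bot (\<lambda>y. ereal (mp_index_real P y)))"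


section \<open>The conditions (PCLI1), (PCLI2), (PCLI3)\<close>

definition PCLI1 :: "project \<Rightarrow> bool" where
  "PCLI1 P \<longleftrightarrow> (\<forall>x\<in>states P. \<forall>z. 0 < marginal_resource P x (threshold_policy z))"

definition PCLI2 :: "project \<Rightarrow> bool" where
  "PCLI2 P \<longleftrightarrow> mono_on (states P) (mp_index P) \<and> continuous_on (states P) (mp_index P)"

text \<open>
  Lebesgue--Stieltjes integral of \<open>h\<close> over \<open>(a, b]\<close> with respect to a nonincreasing right-continuous
  function \<open>\<phi>\<close>: the signed measure giving mass \<open>\<phi> b - \<phi> a\<close> to \<open>(a, b]\<close> is minus the measure generated
  by \<open>- \<phi>\<close>. In \<open>PCLI3\<close> the integrator is \<open>z \<mapsto> G(x, z)\<close>; it is right-continuous by dominated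
  convergence, and nonincreasing under \<open>PCLI1\<close>, because for \<open>z\<^sub>1 < z\<^sub>2\<close> the difference
  \<open>G(x, z\<^sub>1) - G(x, z\<^sub>2)\<close> is the expectation under the \<open>z\<^sub>1\<close>-policy of the discounted sum of
  \<open>g(X\<^sub>t, z\<^sub>2)\<close> over the times \<open>t\<close> with \<open>z\<^sub>1 < X\<^sub>t \<le> z\<^sub>2\<close>.
\<close>

definition stieltjes_integral :: "real \<Rightarrow> real \<Rightarrow> (real \<Rightarrow> real) \<Rightarrow> (real \<Rightarrow> real) \<Rightarrow> real" where
  "stieltjes_integral a b h \<phi> = - (LINT z:{a<..b}|interval_measure (\<lambda>z. - \<phi> z). h z)"

definition PCLI3 :: "project \<Rightarrow> bool" where
  "PCLI3 P \<longleftrightarrow> (\<forall>x\<in>states P. \<forall>z1 z2 :: real. z1 < z2 \<longrightarrow>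
     reward_metric P x (threshold_policy (ereal z2)) -
     reward_metric P x (threshold_policy (ereal z1)) =
     stieltjes_integral z1 z2 (mp_index_real P)
       (\<lambda>z. resource_metric P x (threshold_policy (ereal z))))"


section \<open>Indexability and thresholdability\<close>

definition action_value :: "project \<Rightarrow> real \<Rightarrow> bool \<Rightarrow> real \<Rightarrow> real" where
  "action_value P lam a x = reward P x a - lam * consumption P x a +
     discount P * (\<integral>y. optimal_value P lam y \<partial>kernel P a x)"

definition action_gap :: "project \<Rightarrow> real \<Rightarrow> real \<Rightarrow> real" where
  "action_gap P lam x = action_value P lam True x - action_value P lam False x"

definition indexable_with :: "project \<Rightarrow> (real \<Rightarrow> real) \<Rightarrow> bool" where
  "indexable_with P idx \<longleftrightarrow>
     (\<forall>x\<in>states P. \<forall>lam. sgn (action_gap P lam x) = sgn (idx x - lam))"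

definition optimal_threshold_map :: "project \<Rightarrow> (real \<Rightarrow> ereal) \<Rightarrow> bool" where
  "optimal_threshold_map P zs \<longleftrightarrow> (\<forall>x\<in>states P. \<forall>lam.
     (ereal x \<le> zs lam \<longrightarrow> action_gap P lam x \<le> 0) \<and>
     (zs lam \<le> ereal x \<longrightarrow> 0 \<le> action_gap P lam x))"

definition thresholdable :: "project \<Rightarrow> bool" where
  "thresholdable P \<longleftrightarrow> (\<exists>zs. optimal_threshold_map P zs)"

definition threshold_indexable_with :: "project \<Rightarrow> (real \<Rightarrow> real) \<Rightarrow> bool" where
  "threshold_indexable_with P idx \<longleftrightarrow> thresholdable P \<and> indexable_with P idx"


section \<open>Generalized inverses of the MP index\<close>

text \<open>The last branch does not occur when the MP index is continuous.\<close>

definition inverse_set :: "project \<Rightarrow> real \<Rightarrow> ereal set" where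
  "inverse_set P lam =
     (if \<exists>x\<in>states P. mp_index P x = lam then {z. mp_index_ext P z = ereal lam}
      else if \<forall>x\<in>states P. lam < mp_index P x then
        (if lower_end P = -\<infinity> then {-\<infinity>} else {z. z < lower_end P})
      else if \<forall>x\<in>states P. mp_index P x < lam then
        (if upper_end P = \<infinity> then {\<infinity>} else {z. upper_end P < z})
      else {})"

definition generalized_inverse :: "project \<Rightarrow> (real \<Rightarrow> ereal) \<Rightarrow> bool" where
  "generalized_inverse P \<zeta> \<longleftrightarrow> (\<forall>lam. \<zeta> lam \<in> inverse_set P lam)"

end

theory Submission
  imports Defs
begin

text \<open>
  For a threshold \<open>z\<close>, put \<open>\<Phi>(z) = f(x, z) - m(z) g(x, z)\<close>. Condition (PCLI3), applied to the states
  reached after one step, gives \<open>d\<Phi> = - g(x, z) dm(z)\<close> in the sense of Stieltjes integrals; as \<open>g > 0\<close>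
  and \<open>\<Phi>(x) = 0\<close>, the sign of \<open>\<Phi>(z)\<close> is that of \<open>m(x) - m(z)\<close>. Only an inequality for increments is
  proved, in which the error is a product of an increment of the continuous function \<open>m\<close> and an
  increment of a monotone function \<open>K\<close>; such errors add up to 0 over fine partitions.

  Given \<open>\<lambda>\<close>, choose \<open>z\<close> with \<open>m(z) = \<lambda>\<close>, or \<open>z = \<plusminus>\<infinity>\<close> if there is none. Then
  \<open>f(x, z) - \<lambda> g(x, z)\<close> has the sign of \<open>m(x) - \<lambda>\<close> in all states \<open>x\<close>, so \<open>F(x, z) - \<lambda> G(x, z)\<close> solves
  the Bellman equation. Along the process of an arbitrary policy, the discounted sum of the expected
  Bellman defects is the difference between this function and the value of the policy; hence the
  \<open>z\<close>-policy is optimal and \<open>\<Delta>\<^sub>\<lambda>(x) = f(x, z) - \<lambda> g(x, z)\<close>.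
\<close>

section \<open>A monotonicity lemma for Stieltjes-type increments\<close>

text \<open>For \<open>H = f - m * g\<close>, splitting off \<open>g s * (m t - m s) \<ge> 0\<close>
  leaves \<open>H t - H s \<le> (m t - m s) * (K s - K t)\<close>. On intervals where
  \<open>m\<close> grows by at most \<open>e\<close> this is at most \<open>e * (K s - K t)\<close>,
  a bound that telescopes; finally \<open>e\<close> tends to 0.\<close>

lemma increment_antimono:
  fixes f g m K :: "real \<Rightarrow> real"
  assumes m: "mono m" "continuous_on UNIV m"
    and g: "\<And>s. 0 \<le> g s" and K: "antimono K"
    and incr: "\<And>s t. s < t \<Longrightarrow> f t - f s - m t * (g t - g s) \<le> (m t - m s) * (K s - K t)"
    and "a \<le> b"
  shows "f b - m b * g b \<le> f a - m a * g a"
proof -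
  define H where "H s = f s - m s * g s" for s
  have step: "H t - H s \<le> (m t - m s) * (K s - K t)" if "s < t" for s t
  proof -
    have "H t - H s = f t - f s - m t * (g t - g s) - g s * (m t - m s)"
      by (simp add: H_def algebra_simps)
    also have "\<dots> \<le> (m t - m s) * (K s - K t)"
      using incr[OF that] g[of s] monoD[OF m(1), of s t] that
      by (smt (verit) mult_nonneg_nonneg)
    finally show ?thesis .
  qed
  \<comment> \<open>Bisection replaces an explicit partition and uniform continuity: the bound is
    additive over adjacent intervals and holds on all short intervals around a given point, by
    continuity of \<open>m\<close> there.\<close>
  have "H b - H a \<le> e * (K a - K b)" if "0 < e" for e
  proof (rule Bolzano[where P = "\<lambda>s t. H t - H s \<le> e * (K s - K t)", OF \<open>a \<le> b\<close>])
    fix r s t assume "H s - H r \<le> e * (K r - K s)" "H t - H s \<le> e * (K s - K t)"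
    then show "H t - H r \<le> e * (K r - K t)" by (simp add: algebra_simps)
  next
    fix x assume "a \<le> x" "x \<le> b"
    have "isCont m x" using m(2) by (simp add: continuous_on_eq_continuous_at)
    then obtain d where d: "d > 0" "\<And>y. \<bar>y - x\<bar> < d \<Longrightarrow> \<bar>m y - m x\<bar> < e / 2"
      using \<open>0 < e\<close> by (metis half_gt_zero continuous_at_eps_delta dist_real_def)
    show "\<exists>d>0. \<forall>s t. s \<le> x \<and> x \<le> t \<and> t - s < d \<longrightarrow> H t - H s \<le> e * (K s - K t)"
    proof (intro exI[of _ d] conjI allI impI)
      fix s t assume st: "s \<le> x \<and> x \<le> t \<and> t - s < d"
      show "H t - H s \<le> e * (K s - K t)"
      proof (cases "s = t")
        case False
        then have "s < t" using st by auto
        have "\<bar>m s - m x\<bar> < e / 2" "\<bar>m t - m x\<bar> < e / 2" using d(2) st by auto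
        then have "m t - m s \<le> e" by linarith
        then have "(m t - m s) * (K s - K t) \<le> e * (K s - K t)"
          using antimonoD[OF K, of s t] \<open>s < t\<close> by (intro mult_right_mono) auto
        with step[OF \<open>s < t\<close>] show ?thesis by simp
      qed simp
    qed (use d in auto)
  qed
  moreover have "((\<lambda>e. e * (K a - K b)) \<longlongrightarrow> 0 * (K a - K b)) (at_right 0)"
    by (intro tendsto_intros)
  ultimately have "H b - H a \<le> 0 * (K a - K b)"
    by (intro tendsto_lowerbound[where F = "at_right 0"])
       (auto simp: eventually_at_right_less intro: eventually_mono[OF eventually_at_right_less])
  then show ?thesis by (simp add: H_def)
qed

text \<open>Let \<open>c\<close> be the last point of the interval at which \<open>m\<close> still
  has the value \<open>m a\<close>. Just to the right of \<open>c\<close>, the function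
  \<open>m\<close> has increased, while \<open>K\<close> has dropped by less than \<open>g c\<close>
  because it is right-continuous. Hence the loss \<open>g c * (m t - m c)\<close> outweighs the
  error term, and \<open>H\<close> drops strictly between \<open>c\<close> and \<open>t\<close>;
  elsewhere it does not increase.\<close>

lemma increment_strict_antimono:
  fixes f g m K :: "real \<Rightarrow> real"
  assumes m: "mono m" "continuous_on UNIV m"
    and g: "\<And>s. 0 < g s" and K: "antimono K" "\<And>s. continuous (at_right s) K"
    and incr: "\<And>s t. s < t \<Longrightarrow> f t - f s - m t * (g t - g s) \<le> (m t - m s) * (K s - K t)"
    and ab: "a \<le> b" "m a < m b"
  shows "f b - m b * g b < f a - m a * g a"
proof -
  define H where "H s = f s - m s * g s" for s
  have anti: "H t \<le> H s" if "s \<le> t" for s t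
    unfolding H_def using g less_imp_le
    by (intro increment_antimono[OF m _ K(1) incr that]) auto
  define A where "A = {a..b} \<inter> m -` {m a}"
  have A: "compact A" "A \<noteq> {}" "bdd_above A"
  proof -
    have "closed (m -` {m a})" using m(2) by (simp add: continuous_closed_vimage continuous_on_eq_continuous_at)
    then show "compact A" unfolding A_def by (intro compact_Int_closed) auto
    then show "bdd_above A" by (simp add: bounded_imp_bdd_above compact_imp_bounded)
    show "A \<noteq> {}" using ab by (auto simp: A_def)
  qed
  define c where "c = Sup A"
  have "c \<in> A" unfolding c_def by (intro closed_contains_Sup A compact_imp_closed)
  then have c: "a \<le> c" "c \<le> b" "m c = m a" by (auto simp: A_def)
  then have "c < b" using ab by (metis order_le_less less_irrefl)
  have above: "m c < m t" if "c < t" "t \<le> b" for t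
  proof -
    have "t \<notin> A" using that cSup_upper[OF _ A(3), of t] by (auto simp: c_def)
    then have "m t \<noteq> m a" using that c by (auto simp: A_def)
    then show ?thesis using monoD[OF m(1), of c t] that c by auto
  qed
  have "(K \<longlongrightarrow> K c) (at_right c)" using K(2) by (simp add: continuous_within)
  then have "\<forall>\<^sub>F t in at_right c. K c - g c < K t"
    using g[of c] by (intro order_tendstoD) auto
  moreover have "\<forall>\<^sub>F t in at_right c. c < t \<and> t < b"
    using \<open>c < b\<close> by (simp add: eventually_at_right_field eventually_conj_iff eventually_at_right_less) (meson)
  ultimately have "\<forall>\<^sub>F t in at_right c. K c - g c < K t \<and> c < t \<and> t < b"
    by eventually_elim auto
  then obtain t where t: "K c - g c < K t" "c < t" "t < b"
    using eventually_happens'[OF trivial_limit_at_right_real] by blast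
  have "H t - H c = f t - f c - m t * (g t - g c) - g c * (m t - m c)"
    by (simp add: H_def algebra_simps)
  also have "\<dots> \<le> (m t - m c) * (K c - K t - g c)"
    using incr[OF t(2)] by (simp add: algebra_simps)
  also have "\<dots> < 0" using above[of t] t by (intro mult_pos_neg) auto
  finally have "H t < H c" by simp
  then show ?thesis using anti[of a c] anti[of t b] c t by (simp add: H_def)
qed


section \<open>Discounted one-step expectations\<close>

text \<open>The witnesses of the existential in \<open>valid_project\<close> are fixed here,
  together with the conditions on the kernels and the weight; the bounds on reward and consumption
  are added in \<open>bandit\<close>.\<close>

locale weighted_project =
  fixes P :: project and w :: "real \<Rightarrow> real" and M \<gamma> :: real
  assumes ends: "lower_end P < upper_end P"
    and discount: "0 \<le> discount P" "discount P \<le> \<gamma>" "\<gamma> < 1"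
    and kernel: "\<And>a. kernel P a \<in> state_space P \<rightarrow>\<^sub>M prob_algebra (state_space P)"
    and w_measurable [measurable]: "w \<in> borel_measurable (state_space P)"
    and w_ge_1: "\<And>x. x \<in> states P \<Longrightarrow> 1 \<le> w x"
    and drift: "\<And>x a. x \<in> states P \<Longrightarrow>
      ennreal (discount P) * (\<integral>\<^sup>+ y. ennreal (w y) \<partial>kernel P a x) \<le> ennreal (\<gamma> * w x)"
begin

abbreviation "X \<equiv> states P"
abbreviation "S \<equiv> state_space P"
abbreviation "\<beta> \<equiv> discount P"

text \<open>
  If \<open>\<beta> = 0\<close>, the drift condition does not make \<open>w\<close> integrable and the Bochner integral below may
  be the junk value 0; keeping the factor \<open>\<beta>\<close> inside makes the algebra of \<open>next_value\<close> hold in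
  this case too.
\<close>

definition next_value :: "bool \<Rightarrow> (real \<Rightarrow> real) \<Rightarrow> real \<Rightarrow> real" where
  "next_value a V x = \<beta> * (\<integral>y. V y \<partial>kernel P a x)"

text \<open>The ball of radius \<open>C\<close> in the space of measurable functions with the
  \<open>w\<close>-weighted supremum norm.\<close>

definition weighted :: "real \<Rightarrow> (real \<Rightarrow> real) \<Rightarrow> bool" where
  "weighted C V \<longleftrightarrow> V \<in> borel_measurable S \<and> (\<forall>x\<in>X. \<bar>V x\<bar> \<le> C * w x)"

lemma space_S [simp]: "space S = X"
  by (simp add: state_space_def space_restrict_space)

lemma X_not_empty: "X \<noteq> {}"
proof -
  obtain y where "lower_end P < ereal y" "ereal y < upper_end P"
    using ends ereal_dense2 by blast
  then show ?thesis by (auto simp: states_def intro: exI[of _ y])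
qed

lemma \<gamma>_nonneg: "0 \<le> \<gamma>"
  using discount by linarith

lemma w_pos: "x \<in> X \<Longrightarrow> 0 < w x"
  using w_ge_1[of x] by linarith

lemma weightedD: "weighted C V \<Longrightarrow> x \<in> X \<Longrightarrow> \<bar>V x\<bar> \<le> C * w x"
  by (simp add: weighted_def)

lemma weighted_measurable: "weighted C V \<Longrightarrow> V \<in> borel_measurable S"
  by (simp add: weighted_def)

lemma weighted_nonneg: "weighted C V \<Longrightarrow> 0 \<le> C"
  using X_not_empty w_pos weightedD
  by (metis abs_ge_zero all_not_in_conv order_trans zero_le_mult_iff not_le)

lemma weighted_mono: "weighted C V \<Longrightarrow> C \<le> D \<Longrightarrow> weighted D V"
  unfolding weighted_def using w_pos by (meson less_imp_le mult_right_mono order_trans)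

lemma weighted_w: "weighted 1 w"
  using w_pos by (force simp: weighted_def)

lemma weighted_zero: "weighted 0 (\<lambda>_. 0)"
  by (simp add: weighted_def)

lemma weighted_add:
  assumes "weighted C U" "weighted D V"
  shows "weighted (C + D) (\<lambda>x. U x + V x)"
  using assms unfolding weighted_def
  by (auto simp: algebra_simps intro: order_trans[OF abs_triangle_ineq] add_mono)

lemma weighted_scale:
  assumes "weighted C V"
  shows "weighted (\<bar>k\<bar> * C) (\<lambda>x. k * V x)"
  using assms unfolding weighted_def
  by (auto simp: abs_mult mult.assoc intro: mult_left_mono)

lemma weighted_diff:
  assumes "weighted C U" "weighted D V"
  shows "weighted (C + D) (\<lambda>x. U x - V x)"
  using weighted_add[OF assms(1) weighted_scale[OF assms(2), of "-1"]] by simp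

lemma kernel_sets: "x \<in> X \<Longrightarrow> sets (kernel P a x) = sets S"
  using measurable_space[OF kernel, of x a] by (auto simp: space_prob_algebra)

lemma kernel_space: "x \<in> X \<Longrightarrow> space (kernel P a x) = X"
  using sets_eq_imp_space_eq[OF kernel_sets] by simp

lemma kernel_measurable_eq: "x \<in> X \<Longrightarrow> measurable (kernel P a x) N = measurable S N"
  by (intro measurable_cong_sets kernel_sets refl)

lemma kernel_integrable:
  assumes x: "x \<in> X" and \<beta>: "\<beta> \<noteq> 0" and V: "weighted C V"
  shows "integrable (kernel P a x) V"
proof (rule integrableI_bounded)
  show "V \<in> borel_measurable (kernel P a x)"
    using V x by (simp add: kernel_measurable_eq weighted_measurable)
  have "ennreal \<beta> * (\<integral>\<^sup>+ y. ennreal (w y) \<partial>kernel P a x) < \<infinity>"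
    using drift[OF x, of a] by (rule order_le_less_trans) simp
  then have fin: "(\<integral>\<^sup>+ y. ennreal (w y) \<partial>kernel P a x) < \<infinity>"
    using \<beta> discount(1) by (auto simp: ennreal_mult_less_top)
  have "(\<integral>\<^sup>+ y. ennreal (norm (V y)) \<partial>kernel P a x) \<le> (\<integral>\<^sup>+ y. ennreal C * ennreal (w y) \<partial>kernel P a x)"
    using weightedD[OF V] weighted_nonneg[OF V]
    by (intro nn_integral_mono) (auto simp: kernel_space[OF x] ennreal_mult'[symmetric] intro!: ennreal_leI)
  also have "\<dots> = ennreal C * (\<integral>\<^sup>+ y. ennreal (w y) \<partial>kernel P a x)"
    using x by (intro nn_integral_cmult) (simp add: kernel_measurable_eq)
  also have "\<dots> < \<infinity>" using fin by (simp add: ennreal_mult_less_top)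
  finally show "(\<integral>\<^sup>+ y. ennreal (norm (V y)) \<partial>kernel P a x) < \<infinity>" .
qed

text \<open>A bridge to nonnegative integrals, where conditioning needs no integrability. For
  \<beta> = 0 it also holds if the integral on the right is infinite, since
  \<open>0 * \<infinity> = 0\<close> in \<open>ennreal\<close>.\<close>

lemma ennreal_next_value:
  assumes x: "x \<in> X" and V: "weighted C V" and "\<And>y. y \<in> X \<Longrightarrow> 0 \<le> V y"
  shows "ennreal (next_value a V x) = ennreal \<beta> * (\<integral>\<^sup>+ y. ennreal (V y) \<partial>kernel P a x)"
proof (cases "\<beta> = 0")
  case False
  then show ?thesis
    unfolding next_value_def using discount(1) assms
    by (subst nn_integral_eq_integral[OF kernel_integrable[OF x False V]])
       (auto simp: ennreal_mult' kernel_space)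
qed (simp add: next_value_def)

lemma next_value_w_le:
  assumes x: "x \<in> X"
  shows "next_value a w x \<le> \<gamma> * w x"
proof -
  have "ennreal (next_value a w x) \<le> ennreal (\<gamma> * w x)"
    using drift[OF x] w_pos less_imp_le by (subst ennreal_next_value[OF x weighted_w]) auto
  then show ?thesis
    using \<gamma>_nonneg w_pos[OF x] by (metis ennreal_le_iff less_imp_le mult_nonneg_nonneg)
qed

lemma next_value_linear:
  assumes x: "x \<in> X" and "weighted C U" "weighted D V"
  shows "next_value a (\<lambda>y. k * U y + l * V y) x = k * next_value a U x + l * next_value a V x"
proof (cases "\<beta> = 0")
  case False
  note int = kernel_integrable[OF x False assms(2)] kernel_integrable[OF x False assms(3)]
  then show ?thesis by (simp add: next_value_def algebra_simps)
qed (simp add: next_value_def)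

lemma next_value_scale: "next_value a (\<lambda>y. k * V y) x = k * next_value a V x"
  by (simp add: next_value_def)

lemma next_value_diff:
  assumes x: "x \<in> X" and "weighted C U" "weighted D V"
  shows "next_value a (\<lambda>y. U y - V y) x = next_value a U x - next_value a V x"
  using next_value_linear[OF assms, of a 1 "-1"] by simp

lemma next_value_cong:
  "x \<in> X \<Longrightarrow> (\<And>y. y \<in> X \<Longrightarrow> U y = V y) \<Longrightarrow> next_value a U x = next_value a V x"
  by (auto simp: next_value_def kernel_space intro!: Bochner_Integration.integral_cong)

lemma next_value_mono:
  assumes x: "x \<in> X" and "weighted C U" "weighted D V" and "\<And>y. y \<in> X \<Longrightarrow> U y \<le> V y"
  shows "next_value a U x \<le> next_value a V x"
proof (cases "\<beta> = 0")
  case False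
  then show ?thesis unfolding next_value_def using assms discount(1)
    by (intro mult_left_mono integral_mono kernel_integrable) (auto simp: kernel_space)
qed (simp add: next_value_def)

text \<open>The contraction estimate: \<open>V\<close> lies between \<open>- C * w\<close> and
  \<open>C * w\<close>, and the drift condition shrinks both bounds by the factor \<gamma>.\<close>

lemma weighted_next_value:
  assumes V: "weighted C V"
  shows "weighted (\<gamma> * C) (next_value a V)"
  unfolding weighted_def
proof (intro conjI ballI)
  have "(\<lambda>x. integral\<^sup>L (kernel P a x) V) \<in> borel_measurable S"
    by (rule measurable_compose[OF measurable_prob_algebraD[OF kernel]
          integral_measurable_subprob_algebra[OF weighted_measurable[OF V]]])
  then show "next_value a V \<in> borel_measurable S"
    unfolding next_value_def[abs_def] by measurable
  fix x assume x: "x \<in> X"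
  have Cw: "weighted C (\<lambda>y. C * w y)" "weighted C (\<lambda>y. - C * w y)"
    using weighted_scale[OF weighted_w, of C] weighted_scale[OF weighted_w, of "-C"] weighted_nonneg[OF V] by auto
  have "next_value a V x \<le> next_value a (\<lambda>y. C * w y) x"
    using weightedD[OF V] by (intro next_value_mono[OF x V Cw(1)]) force
  moreover have "next_value a (\<lambda>y. - C * w y) x \<le> next_value a V x"
    using weightedD[OF V] by (intro next_value_mono[OF x Cw(2) V]) force
  moreover have "C * next_value a w x \<le> \<gamma> * C * w x"
    using mult_left_mono[OF next_value_w_le[OF x] weighted_nonneg[OF V]] by (simp add: ac_simps)
  ultimately show "\<bar>next_value a V x\<bar> \<le> \<gamma> * C * w x"
    unfolding next_value_scale by linarith
qed

text \<open>Dominated convergence with majorant \<open>C * w\<close>, which is integrable as soon as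
  \<beta> is not 0.\<close>

lemma next_value_tendsto:
  assumes x: "x \<in> X" and U: "\<And>n. weighted C (U n)" and V: "weighted C V"
    and lim: "\<And>y. y \<in> X \<Longrightarrow> (\<lambda>n. U n y) \<longlonglongrightarrow> V y"
  shows "(\<lambda>n. next_value a (U n) x) \<longlonglongrightarrow> next_value a V x"
proof (cases "\<beta> = 0")
  case False
  have C: "weighted (C * 1) (\<lambda>y. C * w y)"
    using weighted_scale[OF weighted_w, of C] weighted_nonneg[OF V] by simp
  have "(\<lambda>n. integral\<^sup>L (kernel P a x) (U n)) \<longlonglongrightarrow> integral\<^sup>L (kernel P a x) V"
    using x lim weightedD[OF U]
    by (intro integral_dominated_convergence[where w = "\<lambda>y. C * w y"] kernel_integrable[OF x False C])
       (auto simp: kernel_measurable_eq kernel_space intro!: AE_I2 weighted_measurable[OF U] weighted_measurable[OF V])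
  then show ?thesis unfolding next_value_def by (intro tendsto_intros)
qed (simp add: next_value_def)

end


section \<open>The controlled process\<close>

context weighted_project
begin

text \<open>There are only countably many actions, so measurability can be checked for each action
  separately.\<close>

lemma measurable_stage:
  assumes "\<And>a. (\<lambda>x. f (x, a)) \<in> S \<rightarrow>\<^sub>M N"
  shows "f \<in> stage_space P \<rightarrow>\<^sub>M N"
proof -
  have "(\<lambda>s. f (fst s, snd s)) \<in> stage_space P \<rightarrow>\<^sub>M N"
    unfolding stage_space_def
    by (rule measurable_compose_countable[where g = snd]) (auto intro: measurable_compose[OF measurable_fst assms])
  then show ?thesis by simp
qed

lemma space_stage_space: "space (stage_space P) = X \<times> UNIV"
  by (simp add: stage_space_def space_pair_measure)

lemma measurable_fst_stage [measurable]: "fst \<in> stage_space P \<rightarrow>\<^sub>M S"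
  and measurable_snd_stage [measurable]: "snd \<in> stage_space P \<rightarrow>\<^sub>M count_space UNIV"
  by (simp_all add: stage_space_def)

lemma measurable_kernel_stage: "(\<lambda>s. kernel P (snd s) (fst s)) \<in> stage_space P \<rightarrow>\<^sub>M prob_algebra S"
  by (rule measurable_stage) (simp add: kernel)

lemma measurable_state_law:
  assumes x: "x \<in> X"
  shows "state_law P x t \<in> history_space P t \<rightarrow>\<^sub>M prob_algebra S"
proof (cases t)
  case 0
  have "return S x \<in> space (prob_algebra S)"
    using measurable_space[OF measurable_return_prob_space, of x S] x by simp
  with 0 show ?thesis by (simp add: state_law_def[abs_def])
next
  case (Suc s)
  have "(\<lambda>h. h s) \<in> history_space P t \<rightarrow>\<^sub>M stage_space P"
    unfolding history_space_def Suc by (intro measurable_component_singleton) simp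
  then have "(\<lambda>h. kernel P (snd (h s)) (fst (h s))) \<in> history_space P t \<rightarrow>\<^sub>M prob_algebra S"
    by (rule measurable_compose[OF _ measurable_kernel_stage])
  then show ?thesis by (simp add: state_law_def[abs_def] Suc)
qed

lemma measurable_bernoulli_pmf:
  assumes [measurable]: "p \<in> borel_measurable N" and "\<And>x. x \<in> space N \<Longrightarrow> 0 \<le> p x \<and> p x \<le> 1"
  shows "(\<lambda>x. measure_pmf (bernoulli_pmf (p x))) \<in> N \<rightarrow>\<^sub>M prob_algebra (count_space UNIV)"
proof (intro measurable_prob_algebraI measurable_subprob_algebra)
  fix A :: "bool set"
  have "emeasure (measure_pmf (bernoulli_pmf (p x))) A =
      indicator A True * ennreal (p x) + indicator A False * ennreal (1 - p x)" if "x \<in> space N" for x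
    using nn_integral_bernoulli_pmf[of "p x" "indicator A"] assms(2)[OF that] by simp
  then show "(\<lambda>x. emeasure (measure_pmf (bernoulli_pmf (p x))) A) \<in> borel_measurable N"
    by (subst measurable_cong) auto
qed (auto simp: measure_pmf.prob_space_axioms measure_pmf.subprob_space_axioms)

text \<open>The inner measure of the bind in \<open>stage_law\<close>, named so that its joint
  measurability in history and state can be stated.\<close>

definition action_law :: "policy \<Rightarrow> nat \<Rightarrow> trajectory \<Rightarrow> real \<Rightarrow> (real \<times> bool) measure" where
  "action_law \<pi> t h y = distr (measure_pmf (bernoulli_pmf (\<pi> t h y))) (stage_space P) (Pair y)"

lemma measurable_action_law:
  assumes "\<pi> \<in> policies P"
  shows "(\<lambda>(h, y). action_law \<pi> t h y) \<in> history_space P t \<Otimes>\<^sub>M S \<rightarrow>\<^sub>M prob_algebra (stage_space P)"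
proof -
  have "(\<lambda>(h, x). \<pi> t h x) \<in> borel_measurable (history_space P t \<Otimes>\<^sub>M S)"
    and "\<And>h x. h \<in> space (history_space P t) \<Longrightarrow> x \<in> X \<Longrightarrow> 0 \<le> \<pi> t h x \<and> \<pi> t h x \<le> 1"
    using assms by (auto simp: policies_def)
  then have "(\<lambda>z. measure_pmf (bernoulli_pmf (case z of (h, x) \<Rightarrow> \<pi> t h x)))
      \<in> history_space P t \<Otimes>\<^sub>M S \<rightarrow>\<^sub>M prob_algebra (count_space UNIV)"
    by (intro measurable_bernoulli_pmf) (auto simp: space_pair_measure)
  then have "(\<lambda>z. distr (measure_pmf (bernoulli_pmf (case z of (h, x) \<Rightarrow> \<pi> t h x)))
       (stage_space P) (Pair (snd z))) \<in> history_space P t \<Otimes>\<^sub>M S \<rightarrow>\<^sub>M prob_algebra (stage_space P)"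
    by (rule measurable_distr_prob_space2) (simp add: stage_space_def)
  then show ?thesis
    by (simp add: action_law_def split_def)
qed

lemma measurable_stage_law:
  assumes "\<pi> \<in> policies P" "x \<in> X"
  shows "stage_law P \<pi> x t \<in> history_space P t \<rightarrow>\<^sub>M prob_algebra (stage_space P)"
  unfolding stage_law_def[abs_def] action_law_def[symmetric]
  by (rule measurable_bind_prob_space2[OF measurable_state_law[OF assms(2)] measurable_action_law[OF assms(1)]])

lemma nn_integral_stage_law:
  assumes \<pi>: "\<pi> \<in> policies P" and x: "x \<in> X" and h: "h \<in> space (history_space P t)"
    and \<phi> [measurable]: "\<phi> \<in> borel_measurable (stage_space P)"
  shows "(\<integral>\<^sup>+s. \<phi> s \<partial>stage_law P \<pi> x t h) =
    (\<integral>\<^sup>+y. \<phi> (y, True) * ennreal (\<pi> t h y) + \<phi> (y, False) * ennreal (1 - \<pi> t h y) \<partial>state_law P x t h)"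
proof -
  have law: "sets (state_law P x t h) = sets S"
    using measurable_space[OF measurable_state_law[OF x] h] by (simp add: space_prob_algebra)
  have "(\<lambda>y. action_law \<pi> t h y) \<in> S \<rightarrow>\<^sub>M prob_algebra (stage_space P)"
    using measurable_compose[OF measurable_Pair1'[OF h] measurable_action_law[OF \<pi>]] by simp
  then have "action_law \<pi> t h \<in> state_law P x t h \<rightarrow>\<^sub>M subprob_algebra (stage_space P)"
    by (simp add: measurable_prob_algebraD cong: measurable_cong_sets[OF law refl])
  then have "(\<integral>\<^sup>+s. \<phi> s \<partial>stage_law P \<pi> x t h) = (\<integral>\<^sup>+y. \<integral>\<^sup>+s. \<phi> s \<partial>action_law \<pi> t h y \<partial>state_law P x t h)"
    unfolding stage_law_def action_law_def[symmetric] by (rule nn_integral_bind[OF \<phi>])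
  also have "\<dots> = (\<integral>\<^sup>+y. \<phi> (y, True) * ennreal (\<pi> t h y) + \<phi> (y, False) * ennreal (1 - \<pi> t h y) \<partial>state_law P x t h)"
  proof (rule nn_integral_cong)
    fix y assume "y \<in> space (state_law P x t h)"
    then have y: "y \<in> X" using sets_eq_imp_space_eq[OF law] by simp
    then have p: "0 \<le> \<pi> t h y" "\<pi> t h y \<le> 1" using \<pi> h by (auto simp: policies_def)
    have "(\<integral>\<^sup>+s. \<phi> s \<partial>action_law \<pi> t h y) = (\<integral>\<^sup>+a. \<phi> (y, a) \<partial>measure_pmf (bernoulli_pmf (\<pi> t h y)))"
      unfolding action_law_def using y
      by (subst nn_integral_distr) (auto simp: stage_space_def[symmetric], auto simp: stage_space_def space_pair_measure)
    then show "(\<integral>\<^sup>+s. \<phi> s \<partial>action_law \<pi> t h y) = \<phi> (y, True) * ennreal (\<pi> t h y) + \<phi> (y, False) * ennreal (1 - \<pi> t h y)"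
      using p by simp
  qed
  finally show ?thesis .
qed

end

section \<open>The trajectory measure of a fixed policy and starting state\<close>

locale controlled_process = weighted_project +
  fixes \<pi> :: policy and x :: real
  assumes policy: "\<pi> \<in> policies P" and start: "x \<in> states P"

text \<open>\<open>trajectory_law\<close> is built from constants that have their intended meaning
  only under the assumptions of \<open>Ionescu_Tulcea\<close>; an admissible policy and a start in
  the state space guarantee these.\<close>

sublocale controlled_process \<subseteq> IT: Ionescu_Tulcea "stage_law P \<pi> x" "\<lambda>_. stage_space P"
proof (rule Ionescu_Tulcea.intro)
  note law = measurable_stage_law[OF policy start, unfolded history_space_def]
  show "stage_law P \<pi> x t \<in> Pi\<^sub>M {0..<t} (\<lambda>_. stage_space P) \<rightarrow>\<^sub>M subprob_algebra (stage_space P)" for t :: nat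
    by (rule measurable_prob_algebraD[OF law])
  fix t :: nat and h assume "h \<in> space (Pi\<^sub>M {0..<t} (\<lambda>_. stage_space P))"
  then show "prob_space (stage_law P \<pi> x t h)"
    using measurable_space[OF law] by (simp add: space_prob_algebra)
qed

context controlled_process
begin

definition T :: "trajectory measure" where
  "T = trajectory_law P \<pi> x"

lemma T_eq: "T = IT.PF.lim"
  by (simp add: T_def trajectory_law_def)

lemma sets_T [measurable_cong]: "sets T = sets (PiM UNIV (\<lambda>_. stage_space P))"
  by (simp add: T_eq)

lemma space_T: "\<omega> \<in> space T \<Longrightarrow> fst (\<omega> t) \<in> X"
  by (auto simp: T_eq space_PiM space_stage_space PiE_iff mem_Times_iff)

lemma measurable_component_T [measurable]: "(\<lambda>\<omega>. \<omega> t) \<in> T \<rightarrow>\<^sub>M stage_space P"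
  using measurable_component_singleton[of t UNIV "\<lambda>_. stage_space P"]
  by (simp add: measurable_cong_sets[OF sets_T refl])

lemma measurable_restrict_T: "(\<lambda>\<omega>. restrict \<omega> {0..<t}) \<in> T \<rightarrow>\<^sub>M history_space P t"
  unfolding history_space_def by (intro measurable_restrict measurable_component_T)

text \<open>\<open>IT.CI J\<close> is the marginal on \<open>J\<close> of the law of the first
  \<open>IT.up_to J\<close> stages. For an initial segment of length \<open>t\<close> that number is
  \<open>t\<close>, so nothing is lost in the restriction.\<close>

lemma distr_restrict_T:
  "distr T (history_space P t) (\<lambda>\<omega>. restrict \<omega> {0..<t}) = IT.C 0 t (\<lambda>_. undefined)"
proof -
  have "distr T (history_space P t) (\<lambda>\<omega>. restrict \<omega> {0..<t}) = IT.CI {0..<t}"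
    unfolding T_eq history_space_def by (rule IT.distr_lim) simp
  also have "\<dots> = IT.C 0 t (\<lambda>_. undefined)"
  proof -
    have "IT.up_to {0..<t} = t"
      unfolding IT.up_to_def by (rule Least_equality) (auto simp: not_less_eq_eq intro: leI)
    then show ?thesis
      using IT.distr_C[of t t "\<lambda>_. undefined" 0] by (simp add: IT.CI_def)
  qed
  finally show ?thesis .
qed

sublocale T: prob_space T
proof -
  \<comment> \<open>The image of \<open>T\<close> under restriction to the empty history has the
    same total mass as \<open>T\<close>.\<close>
  have "prob_space (distr T (history_space P 0) (\<lambda>\<omega>. restrict \<omega> {0..<0}))"
    unfolding distr_restrict_T by (rule IT.prob_space_C) simp
  then show "prob_space T" using measurable_restrict_T[of 0] by (rule prob_space_distrD[rotated])
qed

text \<open>Conditioning on the history: the first \<open>Suc t\<close> stages arise from the first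
  \<open>t\<close> ones by one draw from \<open>stage_law\<close>, so the last stage can be
  integrated out first.\<close>

lemma nn_integral_component:
  assumes \<phi> [measurable]: "\<phi> \<in> borel_measurable (stage_space P)"
  shows "(\<integral>\<^sup>+\<omega>. \<phi> (\<omega> t) \<partial>T) = (\<integral>\<^sup>+\<omega>. \<integral>\<^sup>+s. \<phi> s \<partial>stage_law P \<pi> x t (restrict \<omega> {0..<t}) \<partial>T)"
proof -
  let ?C = "\<lambda>t. IT.C 0 t (\<lambda>_. undefined)"
  have law: "(\<lambda>h. \<integral>\<^sup>+s. \<phi> s \<partial>stage_law P \<pi> x t h) \<in> borel_measurable (history_space P t)"
    by (rule measurable_compose[OF measurable_prob_algebraD[OF measurable_stage_law[OF policy start]]
          nn_integral_measurable_subprob_algebra[OF \<phi>]])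
  have last: "(\<lambda>h. \<phi> (h t)) \<in> borel_measurable (PiM {0..<Suc t} (\<lambda>_. stage_space P))"
    by (rule measurable_compose[OF _ \<phi>]) (rule measurable_component_singleton, simp)
  have "(\<integral>\<^sup>+\<omega>. \<phi> (\<omega> t) \<partial>T) = (\<integral>\<^sup>+h. \<phi> (h t) \<partial>distr T (history_space P (Suc t)) (\<lambda>\<omega>. restrict \<omega> {0..<Suc t}))"
    using last by (subst nn_integral_distr[OF measurable_restrict_T]) (auto simp: history_space_def)
  also have "\<dots> = (\<integral>\<^sup>+h. \<integral>\<^sup>+h'. \<phi> (h' t) \<partial>IT.eP t h \<partial>?C t)"
    unfolding distr_restrict_T IT.C.simps(2) using last
    by (subst nn_integral_bind[where B = "PiM {0..<Suc t} (\<lambda>_. stage_space P)"])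
       (auto simp: measurable_cong_sets[OF IT.sets_C refl])
  also have "\<dots> = (\<integral>\<^sup>+h. \<integral>\<^sup>+s. \<phi> s \<partial>stage_law P \<pi> x t h \<partial>?C t)"
    using last by (intro nn_integral_cong) (auto simp: IT.space_C IT.nn_integral_eP)
  also have "\<dots> = (\<integral>\<^sup>+\<omega>. \<integral>\<^sup>+s. \<phi> s \<partial>stage_law P \<pi> x t (restrict \<omega> {0..<t}) \<partial>T)"
    unfolding distr_restrict_T[symmetric] using law by (subst nn_integral_distr[OF measurable_restrict_T]) simp_all
  finally show ?thesis .
qed

text \<open>For a function of the state alone, the probabilities of the two actions add up to 1 and
  drop out.\<close>

lemma nn_integral_state:
  assumes \<phi> [measurable]: "\<phi> \<in> borel_measurable S"
  shows "(\<integral>\<^sup>+\<omega>. \<phi> (fst (\<omega> t)) \<partial>T) = (\<integral>\<^sup>+\<omega>. \<integral>\<^sup>+y. \<phi> y \<partial>state_law P x t (restrict \<omega> {0..<t}) \<partial>T)"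
proof -
  have "(\<integral>\<^sup>+s. \<phi> (fst s) \<partial>stage_law P \<pi> x t h) = (\<integral>\<^sup>+y. \<phi> y \<partial>state_law P x t h)"
    if h: "h \<in> space (history_space P t)" for h
  proof -
    have "space (state_law P x t h) = X"
      using measurable_space[OF measurable_state_law[OF start] h]
      by (auto simp: space_prob_algebra dest: sets_eq_imp_space_eq)
    moreover have "\<phi> y * ennreal (\<pi> t h y) + \<phi> y * ennreal (1 - \<pi> t h y) = \<phi> y" if "y \<in> X" for y
    proof -
      have "0 \<le> \<pi> t h y" "\<pi> t h y \<le> 1" using policy h that by (auto simp: policies_def)
      then have "ennreal (\<pi> t h y) + ennreal (1 - \<pi> t h y) = 1"
        by (simp add: ennreal_plus[symmetric] del: ennreal_plus)
      then show ?thesis by (metis distrib_left mult.right_neutral)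
    qed
    ultimately show ?thesis
      by (subst nn_integral_stage_law[OF policy start h]) (auto intro!: nn_integral_cong)
  qed
  then show ?thesis
    using nn_integral_component[of "\<lambda>s. \<phi> (fst s)" t] measurable_space[OF measurable_restrict_T]
    by (simp cong: nn_integral_cong)
qed

lemma nn_integral_state_0:
  assumes "\<phi> \<in> borel_measurable S"
  shows "(\<integral>\<^sup>+\<omega>. \<phi> (fst (\<omega> 0)) \<partial>T) = \<phi> x"
  using nn_integral_state[OF assms, of 0] assms start
  by (simp add: state_law_def nn_integral_return T.emeasure_space_1)

lemma nn_integral_state_Suc:
  assumes "\<phi> \<in> borel_measurable S"
  shows "(\<integral>\<^sup>+\<omega>. \<phi> (fst (\<omega> (Suc t))) \<partial>T) = (\<integral>\<^sup>+\<omega>. \<integral>\<^sup>+y. \<phi> y \<partial>kernel P (snd (\<omega> t)) (fst (\<omega> t)) \<partial>T)"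
  using nn_integral_state[OF assms, of "Suc t"] by (simp add: state_law_def)

lemma AE_start: "AE \<omega> in T. fst (\<omega> 0) = x"
proof -
  have "(\<integral>\<^sup>+\<omega>. indicator {y. y \<noteq> x} (fst (\<omega> 0)) \<partial>T) = (0::ennreal)"
    by (subst nn_integral_state_0) (auto simp: state_space_def intro!: measurable_restrict_space1)
  then have "AE \<omega> in T. indicator {y. y \<noteq> x} (fst (\<omega> 0)) = (0::ennreal)"
    by (subst (asm) nn_integral_0_iff_AE)
       (auto simp: state_space_def intro!: measurable_compose[OF measurable_compose[OF measurable_component_T measurable_fst_stage]] measurable_restrict_space1)
  then show ?thesis by eventually_elim (auto simp: indicator_def split: if_splits)
qed

text \<open>A policy that chooses its action at time \<open>t\<close> deterministically from the
  state follows this choice almost surely: the indicator of disagreement has conditional expectation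
  0 given any history.\<close>

lemma AE_action:
  assumes \<alpha>: "\<And>h y. h \<in> space (history_space P t) \<Longrightarrow> y \<in> X \<Longrightarrow> \<pi> t h y = of_bool (\<alpha> y)"
    and [measurable]: "Measurable.pred S \<alpha>"
  shows "AE \<omega> in T. snd (\<omega> t) = \<alpha> (fst (\<omega> t))"
proof -
  define \<phi> :: "real \<times> bool \<Rightarrow> ennreal" where "\<phi> s = of_bool (snd s \<noteq> \<alpha> (fst s))" for s
  have \<phi> [measurable]: "\<phi> \<in> borel_measurable (stage_space P)"
    unfolding \<phi>_def of_bool_def by measurable
  have "(\<integral>\<^sup>+s. \<phi> s \<partial>stage_law P \<pi> x t h) = 0" if h: "h \<in> space (history_space P t)" for h
  proof -
    have "space (state_law P x t h) = X"
      using measurable_space[OF measurable_state_law[OF start] h]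
      by (auto simp: space_prob_algebra dest: sets_eq_imp_space_eq)
    then have "(\<integral>\<^sup>+s. \<phi> s \<partial>stage_law P \<pi> x t h) = (\<integral>\<^sup>+y. 0 \<partial>state_law P x t h)"
      unfolding nn_integral_stage_law[OF policy start h \<phi>]
      using \<alpha>[OF h] by (intro nn_integral_cong) (auto simp: \<phi>_def)
    then show ?thesis by simp
  qed
  then have "(\<integral>\<^sup>+\<omega>. \<phi> (\<omega> t) \<partial>T) = (\<integral>\<^sup>+\<omega>. 0 \<partial>T)"
    unfolding nn_integral_component[OF \<phi>] using measurable_space[OF measurable_restrict_T]
    by (intro nn_integral_cong) auto
  then have "AE \<omega> in T. \<phi> (\<omega> t) = 0"
    by (intro nn_integral_0_iff_AE[THEN iffD1]) simp_all
  then show ?thesis by eventually_elim (auto simp: \<phi>_def)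
qed

end


section \<open>Discounted sums along the process\<close>

context weighted_project
begin

definition stage_weighted :: "real \<Rightarrow> (real \<Rightarrow> bool \<Rightarrow> real) \<Rightarrow> bool" where
  "stage_weighted C D \<longleftrightarrow> (\<forall>a. weighted C (\<lambda>y. D y a))"

definition disc :: "(real \<Rightarrow> bool \<Rightarrow> real) \<Rightarrow> nat \<Rightarrow> trajectory \<Rightarrow> real" where
  "disc D t \<omega> = \<beta> ^ t * D (fst (\<omega> t)) (snd (\<omega> t))"

text \<open>The Bellman defect: what \<open>V\<close> loses when \<open>a\<close> is taken in state
  \<open>y\<close> and \<open>V\<close> is collected afterwards.\<close>

definition defect :: "(real \<Rightarrow> bool \<Rightarrow> real) \<Rightarrow> (real \<Rightarrow> real) \<Rightarrow> real \<Rightarrow> bool \<Rightarrow> real" where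
  "defect q V y a = V y - q y a - next_value a V y"

lemma stage_weighted_state: "weighted C V \<Longrightarrow> stage_weighted C (\<lambda>y _. V y)"
  by (simp add: stage_weighted_def)

lemma stage_weighted_next_value: "weighted C V \<Longrightarrow> stage_weighted (\<gamma> * C) (\<lambda>y a. next_value a V y)"
  by (simp add: stage_weighted_def weighted_next_value)

lemma stage_weighted_defect:
  assumes "stage_weighted K q" "weighted C V"
  shows "stage_weighted (C + K + \<gamma> * C) (defect q V)"
  using assms unfolding stage_weighted_def defect_def[abs_def]
  by (auto intro!: weighted_diff weighted_next_value)

end

context controlled_process
begin

text \<open>The drift condition, iterated along the process. It gives the discounted stage terms
  geometric bounds in expectation, whatever the policy.\<close>

lemma nn_integral_w_le:
  "ennreal (\<beta> ^ t) * (\<integral>\<^sup>+\<omega>. ennreal (w (fst (\<omega> t))) \<partial>T) \<le> ennreal (\<gamma> ^ t * w x)"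
proof (induction t)
  case 0
  show ?case using nn_integral_state_0[of "\<lambda>y. ennreal (w y)"] by simp
next
  case (Suc t)
  have [measurable]: "(\<lambda>s. \<integral>\<^sup>+y. ennreal (w y) \<partial>kernel P (snd s) (fst s)) \<in> borel_measurable (stage_space P)"
    by (rule measurable_compose[OF measurable_prob_algebraD[OF measurable_kernel_stage]
          nn_integral_measurable_subprob_algebra]) simp
  have "ennreal (\<beta> ^ Suc t) * (\<integral>\<^sup>+\<omega>. ennreal (w (fst (\<omega> (Suc t)))) \<partial>T) =
      ennreal (\<beta> ^ t) * (ennreal \<beta> * (\<integral>\<^sup>+\<omega>. \<integral>\<^sup>+y. ennreal (w y) \<partial>kernel P (snd (\<omega> t)) (fst (\<omega> t)) \<partial>T))"
    using discount(1) nn_integral_state_Suc[of "\<lambda>y. ennreal (w y)"]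
    by (simp add: ennreal_mult' ac_simps)
  also have "\<dots> = ennreal (\<beta> ^ t) * (\<integral>\<^sup>+\<omega>. ennreal \<beta> * (\<integral>\<^sup>+y. ennreal (w y) \<partial>kernel P (snd (\<omega> t)) (fst (\<omega> t))) \<partial>T)"
    by (subst nn_integral_cmult) (auto intro: measurable_compose[OF measurable_component_T])
  also have "\<dots> \<le> ennreal (\<beta> ^ t) * (\<integral>\<^sup>+\<omega>. ennreal \<gamma> * ennreal (w (fst (\<omega> t))) \<partial>T)"
    using drift space_T \<gamma>_nonneg by (intro mult_left_mono nn_integral_mono) (auto simp: ennreal_mult'[symmetric])
  also have "\<dots> = ennreal \<gamma> * (ennreal (\<beta> ^ t) * (\<integral>\<^sup>+\<omega>. ennreal (w (fst (\<omega> t))) \<partial>T))"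
    by (subst nn_integral_cmult)
       (auto simp: ac_simps intro!: measurable_compose[OF measurable_component_T] measurable_compose[OF measurable_fst_stage])
  also have "\<dots> \<le> ennreal \<gamma> * ennreal (\<gamma> ^ t * w x)"
    by (intro mult_left_mono Suc.IH) simp
  also have "\<dots> = ennreal (\<gamma> ^ Suc t * w x)"
    using \<gamma>_nonneg by (simp add: ennreal_mult'[symmetric] ac_simps)
  finally show ?case .
qed

lemma measurable_disc [measurable]:
  assumes "stage_weighted C D"
  shows "disc D t \<in> borel_measurable T"
proof -
  have "(\<lambda>s. D (fst s) (snd s)) \<in> borel_measurable (stage_space P)"
    using assms by (intro measurable_stage) (auto simp: stage_weighted_def intro: weighted_measurable)
  from measurable_compose[OF measurable_component_T this, of t]
  show ?thesis unfolding disc_def[abs_def] by measurable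
qed

lemma nn_integral_disc_le:
  assumes D: "stage_weighted C D"
  shows "(\<integral>\<^sup>+\<omega>. ennreal (norm (disc D t \<omega>)) \<partial>T) \<le> ennreal (C * w x * \<gamma> ^ t)"
proof -
  have C: "0 \<le> C" using D weighted_nonneg by (auto simp: stage_weighted_def)
  have "(\<integral>\<^sup>+\<omega>. ennreal (norm (disc D t \<omega>)) \<partial>T) \<le> (\<integral>\<^sup>+\<omega>. ennreal (C * \<beta> ^ t) * ennreal (w (fst (\<omega> t))) \<partial>T)"
  proof (rule nn_integral_mono)
    fix \<omega> assume "\<omega> \<in> space T"
    then have "\<bar>D (fst (\<omega> t)) (snd (\<omega> t))\<bar> \<le> C * w (fst (\<omega> t))"
      using D space_T by (intro weightedD) (auto simp: stage_weighted_def)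
    then have "norm (disc D t \<omega>) \<le> C * \<beta> ^ t * w (fst (\<omega> t))"
      using mult_left_mono[of "\<bar>D (fst (\<omega> t)) (snd (\<omega> t))\<bar>" "C * w (fst (\<omega> t))" "\<beta> ^ t"] discount(1)
      by (simp add: disc_def abs_mult ac_simps)
    then show "ennreal (norm (disc D t \<omega>)) \<le> ennreal (C * \<beta> ^ t) * ennreal (w (fst (\<omega> t)))"
      using C discount(1) by (subst ennreal_mult'[symmetric]) (auto intro!: ennreal_leI)
  qed
  also have "\<dots> = ennreal C * (ennreal (\<beta> ^ t) * (\<integral>\<^sup>+\<omega>. ennreal (w (fst (\<omega> t))) \<partial>T))"
    using C by (subst nn_integral_cmult)
       (auto simp: ac_simps ennreal_mult' intro!: measurable_compose[OF measurable_component_T] measurable_compose[OF measurable_fst_stage])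
  also have "\<dots> \<le> ennreal C * ennreal (\<gamma> ^ t * w x)"
    by (intro mult_left_mono nn_integral_w_le) simp
  also have "\<dots> = ennreal (C * w x * \<gamma> ^ t)"
    using C by (simp add: ennreal_mult'[symmetric] ac_simps)
  finally show ?thesis .
qed

lemma integrable_disc: "stage_weighted C D \<Longrightarrow> integrable T (disc D t)"
  using nn_integral_disc_le[of C D t]
  by (intro integrableI_bounded measurable_disc) (auto intro: order_le_less_trans)

lemma integral_norm_disc_le:
  assumes D: "stage_weighted C D"
  shows "(\<integral>\<omega>. norm (disc D t \<omega>) \<partial>T) \<le> C * w x * \<gamma> ^ t"
proof -
  have C: "0 \<le> C" using D weighted_nonneg by (auto simp: stage_weighted_def)
  have "ennreal (\<integral>\<omega>. norm (disc D t \<omega>) \<partial>T) \<le> ennreal (C * w x * \<gamma> ^ t)"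
    using nn_integral_disc_le[OF D, of t] integrable_norm[OF integrable_disc[OF D, of t]]
    by (subst nn_integral_eq_integral[symmetric]) auto
  then show ?thesis
    using C w_pos[OF start] \<gamma>_nonneg by (subst (asm) ennreal_le_iff) auto
qed

text \<open>Sum and expectation may be exchanged because the expected absolute terms are dominated
  by a geometric series; by Tonelli's theorem this also gives summability on almost every
  trajectory.\<close>

lemma sums_disc:
  assumes D: "stage_weighted C D"
  shows "(\<lambda>t. \<integral>\<omega>. disc D t \<omega> \<partial>T) sums (\<integral>\<omega>. (\<Sum>t. disc D t \<omega>) \<partial>T)"
proof (rule sums_integral)
  have C: "0 \<le> C" using D weighted_nonneg by (auto simp: stage_weighted_def)
  have geom: "summable (\<lambda>t. C * w x * \<gamma> ^ t)"
    using \<gamma>_nonneg discount(3) by (intro summable_mult summable_geometric) auto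
  show "integrable T (disc D t)" for t by (rule integrable_disc[OF D])
  show "summable (\<lambda>t. \<integral>\<omega>. norm (disc D t \<omega>) \<partial>T)"
    using integral_norm_disc_le[OF D] by (intro summable_comparison_test'[OF geom]) auto
  note [measurable] = measurable_disc[OF D]
  have "(\<integral>\<^sup>+\<omega>. (\<Sum>t. ennreal (norm (disc D t \<omega>))) \<partial>T) = (\<Sum>t. \<integral>\<^sup>+\<omega>. ennreal (norm (disc D t \<omega>)) \<partial>T)"
    by (intro nn_integral_suminf) measurable
  also have "\<dots> \<le> (\<Sum>t. ennreal (C * w x * \<gamma> ^ t))"
    by (intro suminf_le nn_integral_disc_le[OF D]) auto
  also have "\<dots> < \<infinity>"
    using C w_pos[OF start] \<gamma>_nonneg geom by (subst suminf_ennreal2) auto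
  finally have "(\<integral>\<^sup>+\<omega>. (\<Sum>t. ennreal (norm (disc D t \<omega>))) \<partial>T) \<noteq> \<infinity>" by simp
  then have "AE \<omega> in T. (\<Sum>t. ennreal (norm (disc D t \<omega>))) \<noteq> \<infinity>"
    by (intro nn_integral_PInf_AE) measurable
  then show "AE \<omega> in T. summable (\<lambda>t. norm (disc D t \<omega>))"
    by eventually_elim (auto intro: summable_suminf_not_top)
qed

text \<open>The Markov property. For nonnegative functions it follows from conditioning in
  nonnegative integrals; in general, \<open>V\<close> is the difference of the nonnegative functions
  \<open>V + C * w\<close> and \<open>C * w\<close>.\<close>

lemma integral_disc_next_value:
  assumes V: "weighted C V"
  shows "(\<integral>\<omega>. disc (\<lambda>y a. next_value a V y) t \<omega> \<partial>T) = (\<integral>\<omega>. disc (\<lambda>y _. V y) (Suc t) \<omega> \<partial>T)"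
proof -
  have nonneg: "(\<integral>\<omega>. disc (\<lambda>y a. next_value a U y) t \<omega> \<partial>T) = (\<integral>\<omega>. disc (\<lambda>y _. U y) (Suc t) \<omega> \<partial>T)"
    if U: "weighted K U" and pos: "\<And>y. y \<in> X \<Longrightarrow> 0 \<le> U y" for K U
  proof -
    note [measurable] = weighted_measurable[OF U] measurable_disc[OF stage_weighted_state[OF U]]
      measurable_disc[OF stage_weighted_next_value[OF U]]
    have [measurable]: "(\<lambda>s. \<integral>\<^sup>+y. ennreal (U y) \<partial>kernel P (snd s) (fst s)) \<in> borel_measurable (stage_space P)"
      by (rule measurable_compose[OF measurable_prob_algebraD[OF measurable_kernel_stage]
            nn_integral_measurable_subprob_algebra]) simp
    have next_pos: "0 \<le> next_value a U y" if "y \<in> X" for a y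
      using next_value_mono[OF that weighted_zero U] pos by (simp add: next_value_def)
    have "(\<integral>\<^sup>+\<omega>. ennreal (disc (\<lambda>y _. U y) (Suc t) \<omega>) \<partial>T)
        = (\<integral>\<^sup>+\<omega>. ennreal (\<beta> ^ Suc t) * ennreal (U (fst (\<omega> (Suc t)))) \<partial>T)"
      using discount(1) by (intro nn_integral_cong) (simp add: disc_def ennreal_mult')
    also have "\<dots> = ennreal (\<beta> ^ Suc t) * (\<integral>\<^sup>+\<omega>. ennreal (U (fst (\<omega> (Suc t)))) \<partial>T)"
      by (rule nn_integral_cmult) 
         (auto intro!: measurable_compose[OF measurable_component_T] measurable_compose[OF measurable_fst_stage])
    also have "\<dots> = ennreal (\<beta> ^ Suc t) * (\<integral>\<^sup>+\<omega>. \<integral>\<^sup>+y. ennreal (U y) \<partial>kernel P (snd (\<omega> t)) (fst (\<omega> t)) \<partial>T)"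
      by (subst nn_integral_state_Suc) auto
    also have "\<dots> = (\<integral>\<^sup>+\<omega>. ennreal (\<beta> ^ Suc t) * (\<integral>\<^sup>+y. ennreal (U y) \<partial>kernel P (snd (\<omega> t)) (fst (\<omega> t))) \<partial>T)"
      by (rule nn_integral_cmult[symmetric]) (auto intro: measurable_compose[OF measurable_component_T])
    also have "\<dots> = (\<integral>\<^sup>+\<omega>. ennreal (disc (\<lambda>y a. next_value a U y) t \<omega>) \<partial>T)"
    proof (rule nn_integral_cong)
      fix \<omega> assume "\<omega> \<in> space T"
      then have y: "fst (\<omega> t) \<in> X" by (rule space_T)
      show "ennreal (\<beta> ^ Suc t) * (\<integral>\<^sup>+y. ennreal (U y) \<partial>kernel P (snd (\<omega> t)) (fst (\<omega> t))) =
          ennreal (disc (\<lambda>y a. next_value a U y) t \<omega>)"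
        using discount(1) by (simp add: disc_def ennreal_mult' ennreal_next_value[OF y U pos] ac_simps)
    qed
    finally have "(\<integral>\<^sup>+\<omega>. ennreal (disc (\<lambda>y _. U y) (Suc t) \<omega>) \<partial>T) = (\<integral>\<^sup>+\<omega>. ennreal (disc (\<lambda>y a. next_value a U y) t \<omega>) \<partial>T)" .
    then show ?thesis
      using discount(1) pos next_pos space_T
      by (subst (1 2) integral_eq_nn_integral) (auto simp: disc_def simp del: power_Suc)
  qed
  have C: "0 \<le> C" by (rule weighted_nonneg[OF V])
  have Cw: "weighted C (\<lambda>y. C * w y)"
    using weighted_scale[OF weighted_w, of C] C by simp
  have sum: "weighted (C + C) (\<lambda>y. V y + C * w y)" by (rule weighted_add[OF V Cw])
  have 1: "(\<integral>\<omega>. disc (\<lambda>y a. next_value a (\<lambda>y. V y + C * w y) y) t \<omega> \<partial>T) = (\<integral>\<omega>. disc (\<lambda>y _. V y + C * w y) (Suc t) \<omega> \<partial>T)"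
    using weightedD[OF V] by (intro nonneg[OF sum]) force
  have 2: "(\<integral>\<omega>. disc (\<lambda>y a. next_value a (\<lambda>y. C * w y) y) t \<omega> \<partial>T) = (\<integral>\<omega>. disc (\<lambda>y _. C * w y) (Suc t) \<omega> \<partial>T)"
    using C w_pos by (intro nonneg[OF Cw]) (simp add: less_imp_le)
  have "(\<integral>\<omega>. disc (\<lambda>y a. next_value a (\<lambda>y. V y + C * w y) y) t \<omega> \<partial>T) =
      (\<integral>\<omega>. disc (\<lambda>y a. next_value a V y) t \<omega> + disc (\<lambda>y a. next_value a (\<lambda>y. C * w y) y) t \<omega> \<partial>T)"
    using next_value_linear[OF space_T V Cw, where k = 1 and l = 1]
    by (intro Bochner_Integration.integral_cong) (auto simp: disc_def algebra_simps)
  moreover have "\<dots> = (\<integral>\<omega>. disc (\<lambda>y a. next_value a V y) t \<omega> \<partial>T) + (\<integral>\<omega>. disc (\<lambda>y a. next_value a (\<lambda>y. C * w y) y) t \<omega> \<partial>T)"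
    by (rule Bochner_Integration.integral_add[OF integrable_disc[OF stage_weighted_next_value[OF V]]
          integrable_disc[OF stage_weighted_next_value[OF Cw]]])
  moreover have "(\<integral>\<omega>. disc (\<lambda>y _. V y + C * w y) (Suc t) \<omega> \<partial>T) =
      (\<integral>\<omega>. disc (\<lambda>y _. V y) (Suc t) \<omega> + disc (\<lambda>y _. C * w y) (Suc t) \<omega> \<partial>T)"
    by (intro Bochner_Integration.integral_cong) (auto simp: disc_def algebra_simps)
  moreover have "\<dots> = (\<integral>\<omega>. disc (\<lambda>y _. V y) (Suc t) \<omega> \<partial>T) + (\<integral>\<omega>. disc (\<lambda>y _. C * w y) (Suc t) \<omega> \<partial>T)"
    by (rule Bochner_Integration.integral_add[OF integrable_disc[OF stage_weighted_state[OF V]]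
          integrable_disc[OF stage_weighted_state[OF Cw]]])
  ultimately show ?thesis using 1 2 by simp
qed

lemma integral_disc_0:
  assumes V: "weighted C V"
  shows "(\<integral>\<omega>. disc (\<lambda>y _. V y) 0 \<omega> \<partial>T) = V x"
proof -
  have "(\<integral>\<omega>. disc (\<lambda>y _. V y) 0 \<omega> \<partial>T) = (\<integral>\<omega>. V x \<partial>T)"
    using AE_start by (intro integral_cong_AE measurable_disc[OF stage_weighted_state[OF V]])
      (auto elim!: eventually_mono simp: disc_def)
  then show ?thesis by (simp add: T.prob_space)
qed

text \<open>With \<open>U t\<close> the discounted expectation of \<open>V\<close> at time
  \<open>t\<close>, the expected defect is \<open>U t - U (Suc t)\<close> minus the expected stage
  reward. The differences telescope to \<open>U 0 = V x\<close>, as \<open>U\<close> tends to 0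
  geometrically; the rewards add up to the value of the policy.\<close>

lemma defect_sums:
  assumes q: "stage_weighted K q" and V: "weighted C V"
  shows "(\<lambda>t. \<integral>\<omega>. disc (defect q V) t \<omega> \<partial>T) sums (V x - (\<integral>\<omega>. (\<Sum>t. disc q t \<omega>) \<partial>T))"
proof -
  define U where "U t = (\<integral>\<omega>. disc (\<lambda>y _. V y) t \<omega> \<partial>T)" for t
  have "(\<integral>\<omega>. disc (defect q V) t \<omega> \<partial>T) = (U t - U (Suc t)) - (\<integral>\<omega>. disc q t \<omega> \<partial>T)" for t
  proof -
    note int = integrable_disc[OF q, of t] integrable_disc[OF stage_weighted_state[OF V], of t]
      integrable_disc[OF stage_weighted_next_value[OF V], of t]
    have "(\<integral>\<omega>. disc (defect q V) t \<omega> \<partial>T) =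
        (\<integral>\<omega>. disc (\<lambda>y _. V y) t \<omega> - disc q t \<omega> - disc (\<lambda>y a. next_value a V y) t \<omega> \<partial>T)"
      by (simp add: disc_def defect_def right_diff_distrib)
    then show ?thesis
      using int by (simp add: U_def integral_disc_next_value[OF V, symmetric])
  qed
  moreover have "U \<longlonglongrightarrow> 0"
  proof (rule tendsto_rabs_zero_cancel, rule tendsto_sandwich[where f = "\<lambda>_. 0"])
    show "(\<lambda>t. C * w x * \<gamma> ^ t) \<longlonglongrightarrow> 0"
      using \<gamma>_nonneg discount(3) by (intro tendsto_mult_right_zero LIMSEQ_power_zero) auto
    have "\<bar>U t\<bar> \<le> C * w x * \<gamma> ^ t" for t
      using order_trans[OF integral_norm_bound integral_norm_disc_le[OF stage_weighted_state[OF V]]]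
      by (simp add: U_def)
    then show "\<forall>\<^sub>F t in sequentially. \<bar>U t\<bar> \<le> C * w x * \<gamma> ^ t" by simp
  qed auto
  then have "(\<lambda>t. U t - U (Suc t)) sums (U 0 - 0)" by (rule telescope_sums')
  ultimately show ?thesis
    using sums_diff[OF _ sums_disc[OF q]] by (simp add: U_def integral_disc_0[OF V])
qed

text \<open>After time 0 every defect vanishes almost surely, so the series in
  \<open>defect_sums\<close> reduces to its first term. The fixed-point equation is assumed only for
  the times \<open>Suc t\<close>, in order to cover policies with an arbitrary first action as
  well.\<close>

lemma discounted_value_deterministic:
  assumes q: "stage_weighted K q" and V: "weighted C V"
    and \<alpha>: "\<And>t h y. h \<in> space (history_space P t) \<Longrightarrow> y \<in> X \<Longrightarrow> \<pi> t h y = of_bool (\<alpha> t y)"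
    and \<alpha>_measurable: "\<And>t. Measurable.pred S (\<alpha> t)"
    and fixpoint: "\<And>t y. y \<in> X \<Longrightarrow> V y = q y (\<alpha> (Suc t) y) + next_value (\<alpha> (Suc t) y) V y"
  shows "(\<integral>\<omega>. (\<Sum>t. disc q t \<omega>) \<partial>T) = q x (\<alpha> 0 x) + next_value (\<alpha> 0 x) V x"
proof -
  note D = stage_weighted_defect[OF q V]
  have action: "AE \<omega> in T. snd (\<omega> t) = \<alpha> t (fst (\<omega> t))" for t
    using \<alpha> \<alpha>_measurable by (rule AE_action)
  have "(\<integral>\<omega>. disc (defect q V) t \<omega> \<partial>T) = (if t = 0 then defect q V x (\<alpha> 0 x) else 0)" for t
  proof -
    have "AE \<omega> in T. disc (defect q V) t \<omega> = (if t = 0 then defect q V x (\<alpha> 0 x) else 0)"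
      using action[of t] AE_start AE_space
    proof eventually_elim
      case (elim \<omega>)
      then show ?case using space_T[OF elim(3), of t] fixpoint[of "fst (\<omega> t)" "t - 1"]
        by (cases t) (auto simp: disc_def defect_def)
    qed
    then have "(\<integral>\<omega>. disc (defect q V) t \<omega> \<partial>T) = (\<integral>\<omega>. (if t = 0 then defect q V x (\<alpha> 0 x) else 0) \<partial>T)"
      by (intro integral_cong_AE measurable_disc[OF D]) auto
    then show ?thesis by (simp add: T.prob_space)
  qed
  then have "(\<lambda>t. if t = 0 then defect q V x (\<alpha> 0 x) else 0) sums (V x - (\<integral>\<omega>. (\<Sum>t. disc q t \<omega>) \<partial>T))"
    using defect_sums[OF q V] by simp
  from sums_unique2[OF sums_single[of 0 "\<lambda>_. defect q V x (\<alpha> 0 x)"] this]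
  show ?thesis by (simp add: defect_def)
qed

end


section \<open>Values of threshold policies\<close>

context weighted_project
begin

primrec value_iter :: "(real \<Rightarrow> bool \<Rightarrow> real) \<Rightarrow> ereal \<Rightarrow> nat \<Rightarrow> real \<Rightarrow> real" where
  "value_iter q z 0 = (\<lambda>_. 0)"
| "value_iter q z (Suc n) = (\<lambda>y. q y (z < ereal y) + next_value (z < ereal y) (value_iter q z n) y)"

text \<open>Defined as a limit of value iteration and not through \<open>trajectory_law\<close>:
  measurability in the state, the fixed-point equation and continuity in the threshold then follow
  from the contraction. The agreement with the metrics is
  \<open>discounted_threshold_value\<close>.\<close>

definition threshold_value :: "(real \<Rightarrow> bool \<Rightarrow> real) \<Rightarrow> ereal \<Rightarrow> real \<Rightarrow> real" where
  "threshold_value q z y = lim (\<lambda>n. value_iter q z n y)"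

lemma pred_threshold: "Measurable.pred S (\<lambda>y. z < ereal y)"
  unfolding state_space_def by (intro measurable_restrict_space1) measurable

lemma weighted_threshold:
  assumes "stage_weighted C U"
  shows "weighted C (\<lambda>y. U y (z < ereal y))"
proof -
  have "(\<lambda>y. U y a) \<in> borel_measurable S" for a
    using assms by (auto simp: stage_weighted_def intro: weighted_measurable)
  then have "(\<lambda>y. U y (z < ereal y)) \<in> borel_measurable S"
    using pred_threshold by (rule measurable_compose_countable)
  then show ?thesis using assms by (auto simp: stage_weighted_def weighted_def)
qed

lemma weighted_value_iter:
  assumes q: "stage_weighted K q"
  shows "weighted (K / (1 - \<gamma>)) (value_iter q z n)"
proof (induction n)
  case 0
  have "0 \<le> K" using q weighted_nonneg by (auto simp: stage_weighted_def)
  then show ?case using discount(3) by (auto intro!: weighted_mono[OF weighted_zero] divide_nonneg_nonneg)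
next
  case (Suc n)
  \<comment> \<open>The radius \<open>K / (1 - \<gamma>)\<close> is the fixed point of the map that
    sends \<open>C\<close> to \<open>K + \<gamma> * C\<close>.\<close>
  have "K + \<gamma> * (K / (1 - \<gamma>)) = K / (1 - \<gamma>)"
    using discount(3) by (simp add: field_simps)
  with weighted_add[OF weighted_threshold[OF q] weighted_threshold[OF stage_weighted_next_value[OF Suc]], of z z]
  show ?case by simp
qed

lemma weighted_value_iter_increment:
  assumes q: "stage_weighted K q"
  shows "weighted (K * \<gamma> ^ n) (\<lambda>y. value_iter q z (Suc n) y - value_iter q z n y)"
proof (induction n)
  case 0
  show ?case using weighted_threshold[OF q] by (simp add: next_value_def)
next
  case (Suc n)
  let ?d = "\<lambda>y. value_iter q z (Suc n) y - value_iter q z n y"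
  have "value_iter q z (Suc (Suc n)) y - value_iter q z (Suc n) y = next_value (z < ereal y) ?d y" if "y \<in> X" for y
    using next_value_diff[OF that weighted_value_iter[OF q, where z = z and n = "Suc n"] weighted_value_iter[OF q, where z = z and n = n], of "z < ereal y"]
    by simp
  moreover have "weighted (\<gamma> * (K * \<gamma> ^ n)) (\<lambda>y. next_value (z < ereal y) ?d y)"
    by (rule weighted_threshold[OF stage_weighted_next_value[OF Suc]])
  moreover have "(\<lambda>y. value_iter q z (Suc (Suc n)) y - value_iter q z (Suc n) y) \<in> borel_measurable S"
    by (intro borel_measurable_diff weighted_measurable[OF weighted_value_iter[OF q]])
  ultimately show ?case by (auto simp: weighted_def ac_simps simp del: value_iter.simps)
qed

lemma value_iter_sums:
  assumes q: "stage_weighted K q" and y: "y \<in> X"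
  shows "(\<lambda>n. value_iter q z (Suc n) y - value_iter q z n y) sums threshold_value q z y"
proof -
  let ?d = "\<lambda>n. value_iter q z (Suc n) y - value_iter q z n y"
  have "summable (\<lambda>n. K * w y * \<gamma> ^ n)"
    using \<gamma>_nonneg discount(3) by (intro summable_mult summable_geometric) auto
  moreover have "norm (?d n) \<le> K * w y * \<gamma> ^ n" for n
    using weightedD[OF weighted_value_iter_increment[OF q] y, of z n] by (simp add: ac_simps del: value_iter.simps)
  ultimately have "summable ?d" by (rule summable_comparison_test')
  then have s: "?d sums (\<Sum>n. ?d n)" by (rule summable_sums)
  then have "(\<lambda>n. value_iter q z n y) \<longlonglongrightarrow> (\<Sum>n. ?d n)"
    unfolding sums_def sum_lessThan_telescope[of "\<lambda>n. value_iter q z n y"] value_iter.simps(1) diff_0_right .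
  then have "threshold_value q z y = (\<Sum>n. ?d n)"
    unfolding threshold_value_def by (rule limI)
  with s show ?thesis by simp
qed

lemma value_iter_LIMSEQ:
  assumes q: "stage_weighted K q" and y: "y \<in> X"
  shows "(\<lambda>n. value_iter q z n y) \<longlonglongrightarrow> threshold_value q z y"
  using value_iter_sums[OF q y, of z]
  unfolding sums_def sum_lessThan_telescope[of "\<lambda>n. value_iter q z n y"] value_iter.simps(1) diff_0_right .

lemma weighted_threshold_value:
  assumes q: "stage_weighted K q"
  shows "weighted (K / (1 - \<gamma>)) (threshold_value q z)"
  unfolding weighted_def
proof (intro conjI ballI)
  note iter = weighted_value_iter[OF q]
  show "threshold_value q z \<in> borel_measurable S"
    by (rule borel_measurable_LIMSEQ_real[where u = "value_iter q z"])
       (simp_all add: value_iter_LIMSEQ[OF q] weighted_measurable[OF iter])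
  fix y assume y: "y \<in> X"
  show "\<bar>threshold_value q z y\<bar> \<le> K / (1 - \<gamma>) * w y"
    by (rule LIMSEQ_le_const2[OF tendsto_rabs[OF value_iter_LIMSEQ[OF q y]]])
       (intro exI allI impI weightedD[OF iter y])
qed

lemma threshold_value_fixpoint:
  assumes q: "stage_weighted K q" and y: "y \<in> X"
  shows "threshold_value q z y = q y (z < ereal y) + next_value (z < ereal y) (threshold_value q z) y"
proof (rule LIMSEQ_unique)
  show "(\<lambda>n. value_iter q z (Suc n) y) \<longlonglongrightarrow> threshold_value q z y"
    using value_iter_LIMSEQ[OF q y] by (rule LIMSEQ_Suc)
  show "(\<lambda>n. value_iter q z (Suc n) y) \<longlonglongrightarrow> q y (z < ereal y) + next_value (z < ereal y) (threshold_value q z) y"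
    unfolding value_iter.simps
    by (intro tendsto_intros next_value_tendsto[OF y weighted_value_iter[OF q] weighted_threshold_value[OF q]]
        value_iter_LIMSEQ[OF q])
qed

text \<open>Each iterate converges, by induction with dominated convergence. The increments of the
  iteration have a geometric bound independent of the threshold, so Tannery's theorem exchanges the
  limits. Pointwise eventual agreement of decisions covers both limits from the right and limits at
  \<plusminus>\<infinity>.\<close>

lemma threshold_value_tendsto:
  assumes q: "stage_weighted K q" and y: "y \<in> X"
    and z: "\<And>y. y \<in> X \<Longrightarrow> \<forall>\<^sub>F k in sequentially. (\<zeta> k < ereal y) = (z < ereal y)"
  shows "(\<lambda>k. threshold_value q (\<zeta> k) y) \<longlonglongrightarrow> threshold_value q z y"
proof -
  note iter = weighted_value_iter[OF q]
  have *: "(\<lambda>k. value_iter q (\<zeta> k) n y) \<longlonglongrightarrow> value_iter q z n y" if "y \<in> X" for n y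
    using that
  proof (induction n arbitrary: y)
    case (Suc n)
    let ?a = "z < ereal y"
    have "(\<lambda>k. q y ?a + next_value ?a (value_iter q (\<zeta> k) n) y) \<longlonglongrightarrow> q y ?a + next_value ?a (value_iter q z n) y"
      by (intro tendsto_intros next_value_tendsto[OF Suc.prems iter iter] Suc.IH)
    then show ?case
      unfolding value_iter.simps
      by (rule Lim_transform_eventually) (use z[OF Suc.prems] in \<open>auto elim!: eventually_mono\<close>)
  qed simp
  have "(\<lambda>k. \<Sum>n. value_iter q (\<zeta> k) (Suc n) y - value_iter q (\<zeta> k) n y)
      \<longlonglongrightarrow> (\<Sum>n. value_iter q z (Suc n) y - value_iter q z n y)"
  proof (rule tannerys_theorem[where M = "\<lambda>n. K * w y * \<gamma> ^ n", THEN conjunct2, THEN conjunct2])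
    show "(\<lambda>k. value_iter q (\<zeta> k) (Suc n) y - value_iter q (\<zeta> k) n y)
        \<longlonglongrightarrow> value_iter q z (Suc n) y - value_iter q z n y" for n
      by (rule tendsto_diff[OF *[OF y] *[OF y]])
    show "\<forall>\<^sub>F (n, k) in sequentially \<times>\<^sub>F sequentially.
        norm (value_iter q (\<zeta> k) (Suc n) y - value_iter q (\<zeta> k) n y) \<le> K * w y * \<gamma> ^ n"
      using weightedD[OF weighted_value_iter_increment[OF q] y]
      by (intro always_eventually) (auto simp: ac_simps simp del: value_iter.simps)
    show "summable (\<lambda>n. K * w y * \<gamma> ^ n)"
      using \<gamma>_nonneg discount(3) by (intro summable_mult summable_geometric) auto
  qed simp
  then show ?thesis
    using value_iter_sums[OF q y] by (simp add: sums_iff del: value_iter.simps)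
qed

section \<open>Threshold policies are admissible, and their metrics are the limits of value
  iteration\<close>

lemma policiesI:
  assumes "\<And>t h y. \<pi> t h y = of_bool (\<alpha> t y)" "\<And>t. Measurable.pred S (\<alpha> t)"
  shows "\<pi> \<in> policies P"
proof -
  have measurable: "(\<lambda>(h, y). \<pi> t h y) \<in> borel_measurable (history_space P t \<Otimes>\<^sub>M S)" for t
  proof -
    note [measurable] = assms(2)[of t]
    have "(\<lambda>z. if \<alpha> t (snd z) then 1 else 0 :: real) \<in> borel_measurable (history_space P t \<Otimes>\<^sub>M S)"
      by measurable
    then show ?thesis by (simp add: assms(1) split_def of_bool_def)
  qed
  show ?thesis
    unfolding policies_def
  proof (intro CollectI allI conjI ballI)
    show "(\<lambda>(h, y). \<pi> t h y) \<in> borel_measurable (history_space P t \<Otimes>\<^sub>M S)" for t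
      by (rule measurable)
  qed (simp_all add: assms(1))
qed

lemma threshold_policy_eq: "threshold_policy z t h y = of_bool (z < ereal y)"
  by (simp add: threshold_policy_def)

lemma act_then_threshold_eq:
  "act_then a (threshold_policy z) t h y = of_bool (if t = 0 then a else z < ereal y)"
  by (cases t) (auto simp: act_then_def threshold_policy_def)

lemma threshold_policy_in_policies: "threshold_policy z \<in> policies P"
  by (rule policiesI[OF threshold_policy_eq pred_threshold])

lemma act_then_threshold_in_policies: "act_then a (threshold_policy z) \<in> policies P"
proof (rule policiesI[OF act_then_threshold_eq])
  show "Measurable.pred S (\<lambda>y. if t = 0 then a else z < ereal y)" for t :: nat
    by (cases "t = 0") (simp_all add: pred_threshold)
qed

lemma discounted_threshold_value:
  assumes q: "stage_weighted K q" and x: "x \<in> X"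
  shows "(\<integral>\<omega>. (\<Sum>t. disc q t \<omega>) \<partial>trajectory_law P (threshold_policy z) x) = threshold_value q z x"
proof -
  interpret C: controlled_process P w M \<gamma> "threshold_policy z" x
    by unfold_locales (use x threshold_policy_in_policies in auto)
  have "(\<integral>\<omega>. (\<Sum>t. disc q t \<omega>) \<partial>C.T) = q x (z < ereal x) + next_value (z < ereal x) (threshold_value q z) x"
    by (rule C.discounted_value_deterministic[OF q weighted_threshold_value[OF q],
          where \<alpha> = "\<lambda>t y. z < ereal y", OF threshold_policy_eq pred_threshold threshold_value_fixpoint[OF q]])
  then show ?thesis
    using threshold_value_fixpoint[OF q x, of z] unfolding C.T_def by (rule trans[OF _ sym])
qed

lemma discounted_act_then_value:
  assumes q: "stage_weighted K q" and x: "x \<in> X"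
  shows "(\<integral>\<omega>. (\<Sum>t. disc q t \<omega>) \<partial>trajectory_law P (act_then a (threshold_policy z)) x) =
    q x a + next_value a (threshold_value q z) x"
proof -
  interpret C: controlled_process P w M \<gamma> "act_then a (threshold_policy z)" x
    by unfold_locales (use x act_then_threshold_in_policies in auto)
  \<comment> \<open>The condition \<open>Suc t = 0\<close> is left unsimplified so that the equation
    matches the action rule at time \<open>Suc t\<close>.\<close>
  have fixpoint: "threshold_value q z y = q y (if Suc t = 0 then a else z < ereal y) +
      next_value (if Suc t = 0 then a else z < ereal y) (threshold_value q z) y" if "y \<in> X" for t y
    unfolding if_not_P[OF nat.distinct(2)] by (rule threshold_value_fixpoint[OF q that])
  have pred: "Measurable.pred S (\<lambda>y. if t = 0 then a else z < ereal y)" for t :: nat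
    by (cases "t = 0") (simp_all add: pred_threshold)
  have "(\<integral>\<omega>. (\<Sum>t. disc q t \<omega>) \<partial>C.T) =
      q x (if (0::nat) = 0 then a else z < ereal x) + next_value (if (0::nat) = 0 then a else z < ereal x) (threshold_value q z) x"
    by (rule C.discounted_value_deterministic[OF q weighted_threshold_value[OF q],
          where \<alpha> = "\<lambda>t y. if t = 0 then a else z < ereal y", OF act_then_threshold_eq pred fixpoint])
  then show ?thesis by (simp add: C.T_def)
qed

end


section \<open>Metrics of threshold policies\<close>

lemma sgn_eqI:
  fixes a b :: real
  assumes "b < 0 \<Longrightarrow> a < 0" "b = 0 \<Longrightarrow> a = 0" "0 < b \<Longrightarrow> 0 < a"
  shows "sgn a = sgn b"
  using assms by (cases b "0::real" rule: linorder_cases) auto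

locale bandit = weighted_project +
  assumes reward: "stage_weighted M (reward P)"
    and consumption: "stage_weighted M (consumption P)"
begin

abbreviation "F \<equiv> threshold_value (reward P)"
abbreviation "G \<equiv> threshold_value (consumption P)"

definition f :: "ereal \<Rightarrow> real \<Rightarrow> real" where
  "f z x = reward P x True - reward P x False + next_value True (F z) x - next_value False (F z) x"

definition g :: "ereal \<Rightarrow> real \<Rightarrow> real" where
  "g z x = consumption P x True - consumption P x False + next_value True (G z) x - next_value False (G z) x"

lemmas weighted_F = weighted_threshold_value[OF reward]
lemmas weighted_G = weighted_threshold_value[OF consumption]

lemma reward_metric_disc: "reward_metric P x \<pi> = (\<integral>\<omega>. (\<Sum>t. disc (reward P) t \<omega>) \<partial>trajectory_law P \<pi> x)"
  by (simp add: reward_metric_def disc_def)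

lemma resource_metric_disc: "resource_metric P x \<pi> = (\<integral>\<omega>. (\<Sum>t. disc (consumption P) t \<omega>) \<partial>trajectory_law P \<pi> x)"
  by (simp add: resource_metric_def disc_def)

lemma reward_metric_threshold: "x \<in> X \<Longrightarrow> reward_metric P x (threshold_policy z) = F z x"
  by (simp add: reward_metric_disc discounted_threshold_value[OF reward])

lemma resource_metric_threshold: "x \<in> X \<Longrightarrow> resource_metric P x (threshold_policy z) = G z x"
  by (simp add: resource_metric_disc discounted_threshold_value[OF consumption])

lemma marginal_reward_threshold: "x \<in> X \<Longrightarrow> marginal_reward P x (threshold_policy z) = f z x"
  by (simp add: marginal_reward_def f_def reward_metric_disc discounted_act_then_value[OF reward])

lemma marginal_resource_threshold: "x \<in> X \<Longrightarrow> marginal_resource P x (threshold_policy z) = g z x"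
  by (simp add: marginal_resource_def g_def resource_metric_disc discounted_act_then_value[OF consumption])

section \<open>Dependence of the metrics on the threshold\<close>

context
  fixes \<zeta> :: "nat \<Rightarrow> ereal" and z :: ereal
  assumes \<zeta>: "\<And>y. y \<in> X \<Longrightarrow> \<forall>\<^sub>F k in sequentially. (\<zeta> k < ereal y) = (z < ereal y)"
begin

lemma next_F_tendsto: "x \<in> X \<Longrightarrow> (\<lambda>k. next_value a (F (\<zeta> k)) x) \<longlonglongrightarrow> next_value a (F z) x"
  by (rule next_value_tendsto[OF _ weighted_F weighted_F threshold_value_tendsto[OF reward]]) (use \<zeta> in auto)

lemma next_G_tendsto: "x \<in> X \<Longrightarrow> (\<lambda>k. next_value a (G (\<zeta> k)) x) \<longlonglongrightarrow> next_value a (G z) x"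
  by (rule next_value_tendsto[OF _ weighted_G weighted_G threshold_value_tendsto[OF consumption]]) (use \<zeta> in auto)

lemma f_tendsto: "x \<in> X \<Longrightarrow> (\<lambda>k. f (\<zeta> k) x) \<longlonglongrightarrow> f z x"
  unfolding f_def by (intro tendsto_intros next_F_tendsto)

lemma g_tendsto: "x \<in> X \<Longrightarrow> (\<lambda>k. g (\<zeta> k) x) \<longlonglongrightarrow> g z x"
  unfolding g_def by (intro tendsto_intros next_G_tendsto)

end

text \<open>The threshold rule is strict, so decisions are stable when the threshold is approached
  from above; from below, the decision in state \<open>s\<close> itself would differ.\<close>

lemma eventually_threshold_right:
  fixes s y :: real
  assumes "\<And>k. s < r k" "r \<longlonglongrightarrow> s"
  shows "\<forall>\<^sub>F k in sequentially. (ereal (r k) < ereal y) = (ereal s < ereal y)"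
proof (cases "s < y")
  case True
  then have "\<forall>\<^sub>F k in sequentially. r k < y" using assms(2) by (intro order_tendstoD)
  with True show ?thesis by (auto elim!: eventually_mono)
next
  case False
  then have "\<not> r k < y" for k using assms(1)[of k] by linarith
  with False show ?thesis by simp
qed

lemma eventually_threshold_minus: "\<forall>\<^sub>F k in sequentially. (ereal (- real k) < ereal y) = (- \<infinity> < ereal y)"
proof -
  have "\<forall>\<^sub>F k in sequentially. - y < real k"
    using filterlim_real_sequentially by (simp add: filterlim_at_top_dense)
  then show ?thesis by (auto elim!: eventually_mono)
qed

lemma eventually_threshold_plus: "\<forall>\<^sub>F k in sequentially. (ereal (real k) < ereal y) = (\<infinity> < ereal y)"
proof -
  have "\<forall>\<^sub>F k in sequentially. y < real k"
    using filterlim_real_sequentially by (simp add: filterlim_at_top_dense)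
  then show ?thesis by (auto elim!: eventually_mono)
qed

lemma next_G_right_continuous:
  assumes x: "x \<in> X"
  shows "continuous (at_right s) (\<lambda>s. next_value a (G (ereal s)) x)"
  unfolding continuous_within
proof (rule tendsto_at_right_sequentially[of s "s + 1"])
  fix r :: "nat \<Rightarrow> real" assume "\<And>n. s < r n" "r \<longlonglongrightarrow> s"
  then show "(\<lambda>n. next_value a (G (ereal (r n))) x) \<longlonglongrightarrow> next_value a (G (ereal s)) x"
    by (intro next_G_tendsto eventually_threshold_right x)
qed simp

lemma G_right_continuous:
  assumes x: "x \<in> X"
  shows "continuous (at_right s) (\<lambda>s. G (ereal s) x)"
  unfolding continuous_within
proof (rule tendsto_at_right_sequentially[of s "s + 1"])
  fix r :: "nat \<Rightarrow> real" assume "\<And>n. s < r n" "r \<longlonglongrightarrow> s"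
  then show "(\<lambda>n. G (ereal (r n)) x) \<longlonglongrightarrow> G (ereal s) x"
    by (intro threshold_value_tendsto[OF consumption x] eventually_threshold_right)
qed simp

section \<open>Optimality of a threshold policy that is greedy for its own value\<close>

lemma policy_value_le:
  assumes x: "x \<in> X" and \<pi>: "\<pi> \<in> policies P"
    and h: "\<And>y. y \<in> X \<Longrightarrow> if z < ereal y then lam * g z y \<le> f z y else f z y \<le> lam * g z y"
  shows "policy_value P lam x \<pi> \<le> F z x - lam * G z x"
proof -
  interpret C: controlled_process P w M \<gamma> \<pi> x by unfold_locales fact+
  let ?DF = "defect (reward P) (F z)" and ?DG = "defect (consumption P) (G z)"
  note int = C.integrable_disc[OF stage_weighted_defect[OF reward weighted_F[of z]]]
    C.integrable_disc[OF stage_weighted_defect[OF consumption weighted_G[of z]]]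
  have "0 \<le> (\<integral>\<omega>. disc ?DF t \<omega> \<partial>C.T) - lam * (\<integral>\<omega>. disc ?DG t \<omega> \<partial>C.T)" for t
  proof -
    \<comment> \<open>The combined defect is 0 for the action of the \<open>z\<close>-policy. For
      the other action it is plus or minus \<open>f z y - lam * g z y\<close>, with the sign that
      \<open>h\<close> makes nonnegative.\<close>
    have "0 \<le> ?DF y a - lam * ?DG y a" if "y \<in> X" for y a
      using h[OF that] threshold_value_fixpoint[OF reward that, of z] threshold_value_fixpoint[OF consumption that, of z]
      unfolding f_def g_def defect_def
      by (cases "z < ereal y"; cases a) (simp_all add: algebra_simps)
    from this[OF C.space_T]
    have "0 \<le> (\<integral>\<omega>. disc ?DF t \<omega> - lam * disc ?DG t \<omega> \<partial>C.T)"
      using discount(1) by (intro integral_nonneg_AE AE_I2)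
        (simp add: disc_def mult.left_commute[of lam] right_diff_distrib[symmetric])
    then show ?thesis using int by simp
  qed
  moreover have "(\<lambda>t. (\<integral>\<omega>. disc ?DF t \<omega> \<partial>C.T) - lam * (\<integral>\<omega>. disc ?DG t \<omega> \<partial>C.T)) sums
      ((F z x - reward_metric P x \<pi>) - lam * (G z x - resource_metric P x \<pi>))"
    unfolding reward_metric_disc resource_metric_disc C.T_def[symmetric]
    by (intro sums_diff sums_mult C.defect_sums[OF reward weighted_F] C.defect_sums[OF consumption weighted_G])
  ultimately have "0 \<le> (F z x - reward_metric P x \<pi>) - lam * (G z x - resource_metric P x \<pi>)"
    by (metis (no_types, lifting) sums_le sums_zero)
  then show ?thesis by (simp add: policy_value_def algebra_simps)
qed

lemma optimal_value_eq:
  assumes x: "x \<in> X"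
    and h: "\<And>y. y \<in> X \<Longrightarrow> if z < ereal y then lam * g z y \<le> f z y else f z y \<le> lam * g z y"
  shows "optimal_value P lam x = F z x - lam * G z x"
  unfolding optimal_value_def
proof (rule cSup_eq_maximum)
  have "policy_value P lam x (threshold_policy z) = F z x - lam * G z x"
    by (simp add: policy_value_def reward_metric_threshold resource_metric_threshold x)
  then show "F z x - lam * G z x \<in> policy_value P lam x ` policies P"
    using threshold_policy_in_policies by (metis imageI)
qed (use policy_value_le[OF x _ h] in auto)

lemma action_gap_eq:
  assumes x: "x \<in> X"
    and h: "\<And>y. y \<in> X \<Longrightarrow> if z < ereal y then lam * g z y \<le> f z y else f z y \<le> lam * g z y"
  shows "action_gap P lam x = f z x - lam * g z x"
proof -
  have "discount P * (\<integral>y. optimal_value P lam y \<partial>kernel P a x) = next_value a (F z) x - lam * next_value a (G z) x" for a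
  proof -
    have "next_value a (optimal_value P lam) x = next_value a (\<lambda>y. F z y - lam * G z y) x"
      by (rule next_value_cong[OF x optimal_value_eq[OF _ h]])
    then show ?thesis
      using next_value_linear[OF x weighted_F[of z] weighted_G[of z], where a = a and k = 1 and l = "- lam"]
      by (simp add: next_value_def[symmetric])
  qed
  then show ?thesis
    by (simp add: action_gap_def action_value_def f_def g_def algebra_simps)
qed

end


section \<open>The MP index\<close>

locale pcli_project = bandit +
  assumes PCLI1: "PCLI1 P" and PCLI2: "PCLI2 P" and PCLI3: "PCLI3 P"
begin

abbreviation "m \<equiv> mp_index_real P"

lemma g_pos: "x \<in> X \<Longrightarrow> 0 < g z x"
  using PCLI1 by (simp add: PCLI1_def marginal_resource_threshold)

text \<open>
  Lowering the threshold from \<open>z2\<close> to \<open>z1\<close> changes the first action only from passive to active, so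
  by \<open>g > 0\<close> the function \<open>G z2 - G z1\<close> is at most its own discounted expectation after one step.
\<close>

lemma G_antimono:
  assumes "z1 \<le> z2" and x: "x \<in> X"
  shows "G z2 x \<le> G z1 x"
proof -
  define d where "d y = G z2 y - G z1 y" for y
  define C where "C = M / (1 - \<gamma>) + M / (1 - \<gamma>)"
  have d: "weighted C d"
    unfolding d_def[abs_def] C_def by (rule weighted_diff[OF weighted_G weighted_G])
  have next_d: "next_value a d y = next_value a (G z2) y - next_value a (G z1) y" if "y \<in> X" for a y
    unfolding d_def[abs_def] by (rule next_value_diff[OF that weighted_G weighted_G])
  have step: "d y \<le> next_value (z1 < ereal y) d y" if y: "y \<in> X" for y
  proof (cases "(z1 < ereal y) = (z2 < ereal y)")
    case True
    have "d y = next_value (z1 < ereal y) d y"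
      unfolding next_d[OF y] using threshold_value_fixpoint[OF consumption y, of z1]
        threshold_value_fixpoint[OF consumption y, of z2] unfolding True d_def by linarith
    then show ?thesis by simp
  next
    case False
    then have act: "z1 < ereal y" "\<not> z2 < ereal y" using \<open>z1 \<le> z2\<close> by auto
    then show ?thesis
      using threshold_value_fixpoint[OF consumption y, of z1]
        threshold_value_fixpoint[OF consumption y, of z2] g_pos[OF y, of z2]
      unfolding g_def d_def next_d[OF y, unfolded d_def] by (simp add: next_d[OF y, unfolded d_def])
  qed
  \<comment> \<open>Each use of \<open>step\<close> improves the upper bound by the factor \<gamma>,
    so \<open>d\<close> cannot be positive in the limit.\<close>
  have bound: "d y \<le> C * \<gamma> ^ n * w y" if "y \<in> X" for n y
    using that
  proof (induction n arbitrary: y)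
    case 0
    then show ?case using weightedD[OF d, of y] by simp
  next
    case (Suc n)
    let ?a = "z1 < ereal y"
    have C: "0 \<le> C * \<gamma> ^ n" using weighted_nonneg[OF d] \<gamma>_nonneg by simp
    have Cw: "weighted (\<bar>C * \<gamma> ^ n\<bar> * 1) (\<lambda>y. C * \<gamma> ^ n * w y)" by (rule weighted_scale[OF weighted_w])
    have "d y \<le> next_value ?a d y" by (rule step[OF Suc.prems])
    also have "\<dots> \<le> next_value ?a (\<lambda>y. C * \<gamma> ^ n * w y) y"
      by (rule next_value_mono[OF Suc.prems d Cw Suc.IH])
    also have "\<dots> \<le> C * \<gamma> ^ n * (\<gamma> * w y)"
      unfolding next_value_scale by (rule mult_left_mono[OF next_value_w_le[OF Suc.prems] C])
    finally show ?case by (simp add: ac_simps)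
  qed
  have "(\<lambda>n. C * \<gamma> ^ n * w x) \<longlonglongrightarrow> C * 0 * w x"
    using \<gamma>_nonneg discount(3) by (intro tendsto_intros LIMSEQ_power_zero) auto
  then have "d x \<le> 0"
    using bound[OF x] by (intro LIMSEQ_le_const[of "\<lambda>n. C * \<gamma> ^ n * w x"]) auto
  then show ?thesis by (simp add: d_def)
qed

section \<open>The index as a monotone continuous function on the real line\<close>

definition clamp :: "real \<Rightarrow> real" where
  "clamp z = (if ereal z < lower_end P then real_of_ereal (lower_end P)
    else if upper_end P < ereal z then real_of_ereal (upper_end P) else z)"

text \<open>As \<open>clamp\<close> is the nearest-point projection onto the state space, the
  extended index inherits monotonicity and continuity, and its values on the line are its values at
  states.\<close>

lemma m_eq: "m z = mp_index P (clamp z)"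
  by (simp add: mp_index_real_def clamp_def)

lemma clamp_cases:
  obtains "lower_end P = - \<infinity>" "upper_end P = \<infinity>" "clamp = (\<lambda>z. z)"
  | l where "lower_end P = ereal l" "upper_end P = \<infinity>" "clamp = (\<lambda>z. max l z)"
  | u where "lower_end P = - \<infinity>" "upper_end P = ereal u" "clamp = (\<lambda>z. min u z)"
  | l u where "lower_end P = ereal l" "upper_end P = ereal u" "l < u" "clamp = (\<lambda>z. max l (min u z))"
  using ends by (cases "lower_end P"; cases "upper_end P") (auto simp: clamp_def fun_eq_iff)

lemma clamp_in_X: "clamp z \<in> X"
  by (cases rule: clamp_cases) (auto simp: states_def)

lemma clamp_X: "x \<in> X \<Longrightarrow> clamp x = x"
  by (cases rule: clamp_cases) (auto simp: states_def)

lemma clamp_mono: "a \<le> b \<Longrightarrow> clamp a \<le> clamp b"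
  by (cases rule: clamp_cases) auto

lemma clamp_continuous: "continuous_on UNIV clamp"
  by (cases rule: clamp_cases) (auto intro!: continuous_intros)

lemma clamp_greater: "z < clamp z \<Longrightarrow> x \<in> X \<Longrightarrow> clamp z \<le> x"
  by (cases rule: clamp_cases) (auto simp: states_def max_def min_def split: if_splits)

lemma clamp_less: "clamp z < z \<Longrightarrow> x \<in> X \<Longrightarrow> x \<le> clamp z"
  by (cases rule: clamp_cases) (auto simp: states_def max_def min_def split: if_splits)

lemma m_X: "x \<in> X \<Longrightarrow> m x = mp_index P x"
  by (simp add: m_eq clamp_X)

lemma m_mono: "mono m"
  using PCLI2 clamp_in_X clamp_mono by (intro monoI) (auto simp: m_eq PCLI2_def mono_on_def)

lemma m_continuous: "continuous_on UNIV m"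
proof -
  have "continuous_on UNIV (\<lambda>z. mp_index P (clamp z))"
    using PCLI2 clamp_in_X
    by (intro continuous_on_compose2[OF _ clamp_continuous, of X]) (auto simp: PCLI2_def)
  then show ?thesis by (simp add: m_eq[abs_def])
qed

lemma index_mono: "x \<in> X \<Longrightarrow> y \<in> X \<Longrightarrow> x \<le> y \<Longrightarrow> mp_index P x \<le> mp_index P y"
  using PCLI2 by (auto simp: PCLI2_def mono_on_def)

lemma f_at_threshold: "x \<in> X \<Longrightarrow> f (ereal x) x = m x * g (ereal x) x"
  using g_pos[of x "ereal x"]
  by (simp add: m_X mp_index_def marginal_reward_threshold marginal_resource_threshold)

text \<open>By (PCLI3), \<open>F s y - F t y\<close> is the integral of \<open>m\<close> over the
  interval from \<open>s\<close> to \<open>t\<close> with respect to a measure of mass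
  \<open>G s y - G t y\<close> there, and monotonicity puts \<open>m\<close> between
  \<open>m s\<close> and \<open>m t\<close>.\<close>

lemma F_increment:
  assumes y: "y \<in> X" and st: "s < t"
  shows "m s * (G s y - G t y) \<le> F s y - F t y" "F s y - F t y \<le> m t * (G s y - G t y)"
proof -
  define N where "N = interval_measure (\<lambda>z. - G (ereal z) y)"
  have em: "emeasure N {s<..t} = ennreal (G s y - G t y)"
    unfolding N_def using st G_antimono[OF _ y] G_right_continuous[OF y]
    by (subst emeasure_interval_measure_Ioc) (auto intro!: continuous_intros)
  have meas: "measure N {s<..t} = G s y - G t y"
    using em G_antimono[OF _ y, of s t] st by (simp add: measure_def)
  have sets [simp]: "sets N = sets borel" by (simp add: N_def)
  have "m \<in> borel_measurable borel" by (rule borel_measurable_mono[OF m_mono])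
  then have m: "m \<in> borel_measurable N" by (simp add: measurable_cong_sets[OF sets refl])
  have Ioc: "{s<..t} \<in> sets N" by simp
  have int: "set_integrable N {s<..t} m"
    unfolding set_integrable_def
  proof (rule integrableI_bounded_set_indicator[where B = "\<bar>m s\<bar> + \<bar>m t\<bar>", OF Ioc m])
    show "emeasure N {s<..t} < \<infinity>" by (simp add: em)
    show "AE z in N. z \<in> {s<..t} \<longrightarrow> norm (m z) \<le> \<bar>m s\<bar> + \<bar>m t\<bar>"
    proof (intro AE_I2 impI)
      fix z assume "z \<in> {s<..t}"
      then have "m s \<le> m z" "m z \<le> m t" using monoD[OF m_mono] by auto
      then show "norm (m z) \<le> \<bar>m s\<bar> + \<bar>m t\<bar>" by auto
    qed
  qed
  have int_const: "set_integrable N {s<..t} (\<lambda>_. c)" for c :: real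
    unfolding set_integrable_def
    by (rule integrableI_bounded_set_indicator[where B = "\<bar>c\<bar>", OF Ioc]) (simp_all add: em)
  have const: "(LINT z:{s<..t}|N. c) = c * (G s y - G t y)" for c
    by (simp add: set_lebesgue_integral_def meas)
  have "F t y - F s y = - (LINT z:{s<..t}|N. m z)"
  proof -
    have "(\<lambda>z. - resource_metric P y (threshold_policy (ereal z))) = (\<lambda>z. - G (ereal z) y)"
      by (simp add: resource_metric_threshold y)
    then show ?thesis
      using PCLI3 y st by (simp add: PCLI3_def stieltjes_integral_def N_def reward_metric_threshold)
  qed
  moreover have "(LINT z:{s<..t}|N. m s) \<le> (LINT z:{s<..t}|N. m z)"
    using monoD[OF m_mono] by (intro set_integral_mono int int_const) auto
  moreover have "(LINT z:{s<..t}|N. m z) \<le> (LINT z:{s<..t}|N. m t)"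
    using monoD[OF m_mono] by (intro set_integral_mono int int_const) auto
  ultimately show "m s * (G s y - G t y) \<le> F s y - F t y" "F s y - F t y \<le> m t * (G s y - G t y)"
    by (simp_all add: const)
qed

section \<open>The sign of the marginal gap in a fixed state\<close>

context
  fixes x :: real
  assumes x: "x \<in> states P"
begin

text \<open>The middle expression is \<open>next_value True H x - next_value False H x\<close> for
  \<open>H = (F t - F s) + m t * (G s - G t)\<close>. By \<open>F_increment\<close>,
  \<open>H\<close> lies between 0 and \<open>(m t - m s) * (G s - G t)\<close>; each bound comes
  from estimating one term and dropping the other by its sign.\<close>

lemma marginal_increment:
  assumes st: "s < t"
  shows "f t x - f s x - m t * (g t x - g s x)
      \<le> (m t - m s) * (next_value True (G s) x - next_value True (G t) x)"
    and "- (m t - m s) * (next_value False (G s) x - next_value False (G t) x)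
      \<le> f t x - f s x - m t * (g t x - g s x)"
proof -
  define dF where "dF y = F t y - F s y" for y
  define dG where "dG y = G s y - G t y" for y
  note wF = weighted_diff[OF weighted_F weighted_F, of t s, folded dF_def]
  note wG = weighted_diff[OF weighted_G weighted_G, of s t, folded dG_def]
  \<comment> \<open>The factor 1 gives \<open>H\<close> the shape of the linear combination in
    \<open>next_value_linear\<close>.\<close>
  define H where "H y = 1 * dF y + m t * dG y" for y
  note wH = weighted_add[OF weighted_scale[OF wF, of 1] weighted_scale[OF wG, of "m t"], folded H_def]
  note wGm = weighted_scale[OF wG, of "m t - m s"]
  have H: "0 \<le> H y" "H y \<le> (m t - m s) * dG y" if "y \<in> X" for y
    using F_increment[OF that st] by (simp_all add: H_def dF_def dG_def algebra_simps)
  have next_dF: "next_value a dF x = next_value a (F t) x - next_value a (F s) x" for a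
    unfolding dF_def[abs_def] by (rule next_value_diff[OF x weighted_F weighted_F])
  have next_dG: "next_value a dG x = next_value a (G s) x - next_value a (G t) x" for a
    unfolding dG_def[abs_def] by (rule next_value_diff[OF x weighted_G weighted_G])
  have next_H: "next_value a H x = next_value a dF x + m t * next_value a dG x" for a
    unfolding H_def[abs_def] using next_value_linear[OF x wF wG, of a 1 "m t"] by simp
  have "0 \<le> next_value a H x" for a
    using next_value_mono[OF x weighted_zero wH H(1)] by (simp add: next_value_def)
  moreover have "next_value a H x \<le> (m t - m s) * next_value a dG x" for a
    using next_value_mono[OF x wH wGm H(2)] by (simp add: next_value_scale)
  moreover have "f t x - f s x - m t * (g t x - g s x) = next_value True H x - next_value False H x"
    by (simp add: f_def g_def next_H next_dF next_dG algebra_simps)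
  ultimately show "f t x - f s x - m t * (g t x - g s x)
      \<le> (m t - m s) * (next_value True (G s) x - next_value True (G t) x)"
    and "- (m t - m s) * (next_value False (G s) x - next_value False (G t) x)
      \<le> f t x - f s x - m t * (g t x - g s x)"
    unfolding next_dG[symmetric] by (smt (verit) mult_minus_left)+
qed

text \<open>The function \<Phi> of the introduction, for the fixed state \<open>x\<close>.\<close>

definition potential :: "real \<Rightarrow> real" where
  "potential s = f s x - m s * g s x"

lemma next_G_antimono: "antimono (\<lambda>s. next_value True (G (ereal s)) x)"
  by (intro antimonoI next_value_mono[OF x weighted_G weighted_G] G_antimono) auto

lemma potential_antimono: "s \<le> t \<Longrightarrow> potential t \<le> potential s"
  unfolding potential_def
  by (rule increment_antimono[OF m_mono m_continuous _ next_G_antimono marginal_increment(1)])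
     (simp_all add: g_pos[OF x] less_imp_le)

lemma potential_strict_antimono: "s \<le> t \<Longrightarrow> m s < m t \<Longrightarrow> potential t < potential s"
  unfolding potential_def
  by (rule increment_strict_antimono[OF m_mono m_continuous _ next_G_antimono next_G_right_continuous[OF x]
        marginal_increment(1)])
     (simp_all add: g_pos[OF x])

text \<open>If \<open>m\<close> has the same value at both points, the upper and lower errors in
  \<open>marginal_increment\<close> are both 0.\<close>

lemma potential_const:
  assumes "m s = m t"
  shows "potential s = potential t"
proof -
  have "potential s = potential t" if "s < t" "m s = m t" for s t
    using marginal_increment[OF that(1)] that(2) by (simp add: potential_def algebra_simps)
  then show ?thesis using assms by (cases s t rule: linorder_cases) auto
qed

lemma potential_self: "potential x = 0"
  by (simp add: potential_def f_at_threshold[OF x])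

lemma gap_at_real:
  assumes "m z = lam"
  shows "sgn (f z x - lam * g z x) = sgn (mp_index P x - lam)"
proof -
  have "f z x - lam * g z x = potential z" by (simp add: potential_def assms)
  moreover have "sgn (potential z) = sgn (m x - m z)"
  proof (rule sgn_eqI)
    assume "m x - m z < 0"
    then have lt: "m x < m z" by simp
    then have "x \<le> z" using monoD[OF m_mono, of z x] by (meson le_cases not_le)
    then show "potential z < 0" using potential_strict_antimono[OF _ lt] potential_self by simp
  next
    assume "m x - m z = 0"
    then show "potential z = 0" using potential_const[of x z] potential_self by simp
  next
    assume "0 < m x - m z"
    then have lt: "m z < m x" by simp
    then have "z \<le> x" using monoD[OF m_mono, of x z] by (meson le_cases not_le)
    then show "0 < potential z" using potential_strict_antimono[OF _ lt] potential_self by simp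
  qed
  ultimately show ?thesis by (simp add: m_X[OF x] assms)
qed

lemma gap_eq_potential: "f s x - lam * g s x = potential s + (m s - lam) * g s x" for s :: real
  by (simp add: potential_def algebra_simps)

text \<open>The gap is a limit along the thresholds \<open>- k\<close>, so it has to be kept away
  from 0. If \<open>m\<close> is smaller than \<open>m x\<close> at some \<open>s\<close> to the
  left of \<open>x\<close>, then \<open>potential s > 0\<close> is a lower bound. Otherwise
  \<open>m\<close> is constant to the left of \<open>x\<close>, and the limit is at least
  \<open>(m x - lam) * g (- \<infinity>) x\<close>, which is positive by (PCLI1) at the infinite
  threshold.\<close>

lemma gap_at_minus_infinity:
  assumes above: "\<And>y. y \<in> X \<Longrightarrow> lam < mp_index P y"
  shows "0 < f (- \<infinity>) x - lam * g (- \<infinity>) x"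
proof -
  have m_above: "lam < m s" for s using above[OF clamp_in_X] by (simp add: m_eq)
  define a where "a k = f (ereal (- real k)) x - lam * g (ereal (- real k)) x" for k
  have lim_g: "(\<lambda>k. g (ereal (- real k)) x) \<longlonglongrightarrow> g (- \<infinity>) x"
    by (rule g_tendsto[OF eventually_threshold_minus x])
  have lim: "a \<longlonglongrightarrow> f (- \<infinity>) x - lam * g (- \<infinity>) x"
    unfolding a_def by (intro tendsto_intros lim_g f_tendsto[OF eventually_threshold_minus x])
  have large: "\<forall>\<^sub>F k in sequentially. s \<le> real k" for s
    using filterlim_real_sequentially by (simp add: filterlim_at_top)
  have small: "\<forall>\<^sub>F k in sequentially. - real k \<le> s" for s
    using large[of "- s"] by eventually_elim simp
  show ?thesis
  proof (cases "\<exists>s\<le>x. m s < m x")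
    case True
    then obtain s where s: "s \<le> x" "m s < m x" by auto
    then have "0 < potential s" using potential_strict_antimono[OF s] potential_self by simp
    moreover have "\<forall>\<^sub>F k in sequentially. potential s \<le> a k"
      using small[of s]
    proof eventually_elim
      case (elim k)
      have "0 \<le> (m (- real k) - lam) * g (ereal (- real k)) x"
        using m_above[of "- real k"] g_pos[OF x, of "ereal (- real k)"] by simp
      then show ?case using potential_antimono[OF elim] unfolding a_def gap_eq_potential by linarith
    qed
    ultimately show ?thesis using tendsto_lowerbound[OF lim] by (meson order_less_le_trans trivial_limit_sequentially)
  next
    case False
    have "\<forall>\<^sub>F k in sequentially. (m x - lam) * g (ereal (- real k)) x \<le> a k"
      using small[of x]
    proof eventually_elim
      case (elim k)
      then have "m (- real k) = m x" using False monoD[OF m_mono elim] by (meson order_le_less)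
      then show ?case using potential_antimono[OF elim] potential_self unfolding a_def gap_eq_potential by simp
    qed
    then have "(m x - lam) * g (- \<infinity>) x \<le> f (- \<infinity>) x - lam * g (- \<infinity>) x"
      by (intro tendsto_le[OF trivial_limit_sequentially lim tendsto_mult_left[OF lim_g]])
    moreover have "0 < (m x - lam) * g (- \<infinity>) x"
      using m_above[of x] g_pos[OF x] by simp
    ultimately show ?thesis by linarith
  qed
qed

text \<open>The mirror image of the previous argument, with thresholds \<open>k\<close> and the
  behaviour of \<open>m\<close> to the right of \<open>x\<close>.\<close>

lemma gap_at_infinity:
  assumes below: "\<And>y. y \<in> X \<Longrightarrow> mp_index P y < lam"
  shows "f \<infinity> x - lam * g \<infinity> x < 0"
proof -
  have m_below: "m s < lam" for s using below[OF clamp_in_X] by (simp add: m_eq)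
  define a where "a k = f (ereal (real k)) x - lam * g (ereal (real k)) x" for k
  have lim_g: "(\<lambda>k. g (ereal (real k)) x) \<longlonglongrightarrow> g \<infinity> x"
    by (rule g_tendsto[OF eventually_threshold_plus x])
  have lim: "a \<longlonglongrightarrow> f \<infinity> x - lam * g \<infinity> x"
    unfolding a_def by (intro tendsto_intros lim_g f_tendsto[OF eventually_threshold_plus x])
  have large: "\<forall>\<^sub>F k in sequentially. s \<le> real k" for s
    using filterlim_real_sequentially by (simp add: filterlim_at_top)
  show ?thesis
  proof (cases "\<exists>s\<ge>x. m x < m s")
    case True
    then obtain s where s: "x \<le> s" "m x < m s" by auto
    then have "potential s < 0" using potential_strict_antimono[OF s] potential_self by simp
    moreover have "\<forall>\<^sub>F k in sequentially. a k \<le> potential s"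
      using large[of s]
    proof eventually_elim
      case (elim k)
      have "(m (real k) - lam) * g (ereal (real k)) x \<le> 0"
        using m_below[of "real k"] g_pos[OF x, of "ereal (real k)"] by (simp add: mult_nonpos_nonneg)
      then show ?case using potential_antimono[OF elim] unfolding a_def gap_eq_potential by linarith
    qed
    ultimately show ?thesis using tendsto_upperbound[OF lim] by (meson order_le_less_trans trivial_limit_sequentially)
  next
    case False
    have "\<forall>\<^sub>F k in sequentially. a k \<le> (m x - lam) * g (ereal (real k)) x"
      using large[of x]
    proof eventually_elim
      case (elim k)
      then have "\<not> m x < m (real k)" using False by blast
      then have "m (real k) = m x" using monoD[OF m_mono elim] by simp
      then show ?case using potential_antimono[OF elim] potential_self unfolding a_def gap_eq_potential by simp
    qed
    then have "f \<infinity> x - lam * g \<infinity> x \<le> (m x - lam) * g \<infinity> x"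
      by (intro tendsto_le[OF trivial_limit_sequentially tendsto_mult_left[OF lim_g] lim])
    moreover have "(m x - lam) * g \<infinity> x < 0"
      using m_below[of x] g_pos[OF x] by (simp add: mult_neg_pos)
    ultimately show ?thesis by linarith
  qed
qed

end

section \<open>Separating thresholds and the action gap\<close>

lemma index_dichotomy:
  assumes "\<And>x. x \<in> X \<Longrightarrow> mp_index P x \<noteq> lam"
  shows "(\<forall>x\<in>X. lam < mp_index P x) \<or> (\<forall>x\<in>X. mp_index P x < lam)"
proof (rule ccontr)
  assume "\<not> ?thesis"
  then obtain a b where ab: "a \<in> X" "b \<in> X" "m a < lam" "lam < m b"
    using assms m_X by (metis linorder_neqE)
  then have "a \<le> b" using monoD[OF m_mono, of b a] by (meson le_cases less_le_not_le less_trans)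
  then obtain c where "m c = lam"
    using IVT'[of m a lam b] ab continuous_on_subset[OF m_continuous] by auto
  then show False using assms[OF clamp_in_X[of c]] by (simp add: m_eq)
qed

text \<open>Optimality of the threshold \<open>z\<close> at charge \<open>lam\<close>, with the sign
  of the action gap replaced by that of \<open>mp_index P x - lam\<close>. In a state
  \<open>x = z\<close> both implications apply and force equality.\<close>

definition separates :: "ereal \<Rightarrow> real \<Rightarrow> bool" where
  "separates z lam \<longleftrightarrow>
    (\<forall>x\<in>X. (ereal x \<le> z \<longrightarrow> mp_index P x \<le> lam) \<and> (z \<le> ereal x \<longrightarrow> lam \<le> mp_index P x))"

lemma threshold_gap:
  obtains z where "\<And>x. x \<in> X \<Longrightarrow> sgn (f z x - lam * g z x) = sgn (mp_index P x - lam)" "separates z lam"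
proof -
  consider (eq) c where "c \<in> X" "mp_index P c = lam"
    | (above) "\<forall>x\<in>X. lam < mp_index P x" | (below) "\<forall>x\<in>X. mp_index P x < lam"
    using index_dichotomy by blast
  then show ?thesis
  proof cases
    case eq
    then show ?thesis
      using index_mono by (intro that[of "ereal c"] gap_at_real) (auto simp: m_X separates_def)
  next
    case above
    then show ?thesis
      using gap_at_minus_infinity[of _ lam] by (intro that[of "- \<infinity>"]) (auto simp: separates_def less_imp_le)
  next
    case below
    then show ?thesis
      using gap_at_infinity[of _ lam] by (intro that[of \<infinity>]) (auto simp: separates_def less_imp_le)
  qed
qed

lemma sgn_action_gap:
  assumes x: "x \<in> X"
  shows "sgn (action_gap P lam x) = sgn (mp_index P x - lam)"
proof -
  obtain z where z: "\<And>x. x \<in> X \<Longrightarrow> sgn (f z x - lam * g z x) = sgn (mp_index P x - lam)"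
    and sep: "separates z lam"
    using threshold_gap[where lam = lam] by blast
  \<comment> \<open>Separation turns the sign of the marginal gap into the statement that the
    \<open>z\<close>-policy acts greedily, so that \<open>action_gap_eq\<close> applies.\<close>
  have greedy: "if z < ereal y then lam * g z y \<le> f z y else f z y \<le> lam * g z y" if y: "y \<in> X" for y
  proof (cases "z < ereal y")
    case True
    then have "0 \<le> sgn (f z y - lam * g z y)" using sep y unfolding z[OF y] by (auto simp: separates_def)
    with True show ?thesis by simp
  next
    case False
    then have "sgn (f z y - lam * g z y) \<le> 0" using sep y unfolding z[OF y] by (auto simp: separates_def)
    with False show ?thesis by simp
  qed
  show ?thesis using z[OF x] action_gap_eq[OF x greedy] by simp
qed

lemma optimal_threshold_map_iff: "optimal_threshold_map P \<zeta> \<longleftrightarrow> (\<forall>lam. separates (\<zeta> lam) lam)"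
proof -
  have gap: "action_gap P lam x \<le> 0 \<longleftrightarrow> mp_index P x \<le> lam" "0 \<le> action_gap P lam x \<longleftrightarrow> lam \<le> mp_index P x"
    if "x \<in> X" for x lam
    using sgn_action_gap[OF that, of lam]
    by (metis diff_le_0_iff_le sgn_le_0_iff, metis diff_ge_0_iff_ge zero_le_sgn_iff)
  show ?thesis
    unfolding optimal_threshold_map_def separates_def by (auto simp: gap)
qed

section \<open>Separating thresholds are the elements of the inverse sets\<close>

lemma separates_real:
  assumes c: "c \<in> X" "mp_index P c = lam"
  shows "separates (ereal z) lam \<longleftrightarrow> m z = lam"
proof
  assume "m z = lam"
  then show "separates (ereal z) lam"
    using monoD[OF m_mono] by (auto simp: separates_def m_X[symmetric])
next
  assume "separates (ereal z) lam"
  then have sep: "x \<le> z \<longrightarrow> mp_index P x \<le> lam" "z \<le> x \<longrightarrow> lam \<le> mp_index P x" if "x \<in> X" for x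
    using that by (auto simp: separates_def)
  consider "clamp z = z" | "z < clamp z" | "clamp z < z" by linarith
  then show "m z = lam"
  proof cases
    case 1
    then show ?thesis using sep[OF clamp_in_X[of z]] by (simp add: m_eq)
  next
    \<comment> \<open>Here \<open>z\<close> lies to the left of all states, so separation only
      yields \<open>lam \<le> m z\<close>; the reverse inequality comes from the state
      \<open>c\<close>, which is at least \<open>clamp z\<close> and has index
      \<open>lam\<close>.\<close>
    case 2
    then show ?thesis
      using sep(2)[OF clamp_in_X[of z]] index_mono[OF clamp_in_X c(1) clamp_greater[OF 2 c(1)]] c by (simp add: m_eq)
  next
    case 3
    then show ?thesis
      using sep(1)[OF clamp_in_X[of z]] index_mono[OF c(1) clamp_in_X clamp_less[OF 3 c(1)]] c by (simp add: m_eq)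
  qed
qed

text \<open>A monotone function converges to its supremum; in \<open>ereal\<close> this includes an
  unbounded index.\<close>

lemma mp_index_ext_infinity: "mp_index_ext P \<infinity> = (SUP y. ereal (m y))"
proof -
  have "((\<lambda>y. ereal (m y)) \<longlongrightarrow> (SUP y. ereal (m y))) at_top"
  proof (rule increasing_tendsto)
    show "\<forall>\<^sub>F y in at_top. ereal (m y) \<le> (SUP y. ereal (m y))"
      by (intro always_eventually allI SUP_upper UNIV_I)
    fix b assume "b < (SUP y. ereal (m y))"
    then obtain y where "b < ereal (m y)" by (auto simp: less_SUP_iff)
    then have "b < ereal (m s)" if "y \<le> s" for s
      using monoD[OF m_mono that] by (meson ereal_less_eq(3) less_le_trans)
    then show "\<forall>\<^sub>F y in at_top. b < ereal (m y)"
      using eventually_ge_at_top[of y] by (rule eventually_mono[rotated])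
  qed
  then have "Lim at_top (\<lambda>y. ereal (m y)) = (SUP y. ereal (m y))" by (intro tendsto_Lim) auto
  then show ?thesis unfolding mp_index_ext_def infinity_ereal_def ereal.case .
qed

lemma mp_index_ext_minus_infinity: "mp_index_ext P (- \<infinity>) = (INF y. ereal (m y))"
proof -
  have "((\<lambda>y. ereal (m y)) \<longlongrightarrow> (INF y. ereal (m y))) at_bot"
  proof (rule decreasing_tendsto)
    show "\<forall>\<^sub>F y in at_bot. (INF y. ereal (m y)) \<le> ereal (m y)"
      by (intro always_eventually allI INF_lower UNIV_I)
    fix b assume "(INF y. ereal (m y)) < b"
    then obtain y where "ereal (m y) < b" by (auto simp: INF_less_iff)
    then have "ereal (m s) < b" if "s \<le> y" for s
      using monoD[OF m_mono that] by (meson ereal_less_eq(3) le_less_trans)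
    then show "\<forall>\<^sub>F y in at_bot. ereal (m y) < b"
      using eventually_le_at_bot[of y] by (rule eventually_mono[rotated])
  qed
  then have "Lim at_bot (\<lambda>y. ereal (m y)) = (INF y. ereal (m y))" by (intro tendsto_Lim) auto
  then show ?thesis unfolding mp_index_ext_def infinity_ereal_def uminus_ereal.simps ereal.case .
qed

text \<open>At an infinite threshold one implication is vacuous, so separation only says that
  \<open>lam\<close> bounds \<open>m\<close> from one side. As \<open>lam\<close> is attained at
  \<open>c\<close>, it is then the supremum or infimum, which is the extended index there.\<close>

lemma separates_iff_mp_index_ext:
  assumes c: "c \<in> X" "mp_index P c = lam"
  shows "separates z lam \<longleftrightarrow> mp_index_ext P z = ereal lam"
proof (cases z)
  case (real y)
  then show ?thesis using separates_real[OF c, of y] by (simp add: mp_index_ext_def)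
next
  case PInf
  have "separates \<infinity> lam \<longleftrightarrow> (\<forall>y. m y \<le> lam)"
    using clamp_in_X m_X by (auto simp: separates_def m_eq) (metis clamp_X)
  also have "\<dots> \<longleftrightarrow> (SUP y. ereal (m y)) \<le> ereal lam" by (simp add: SUP_le_iff)
  also have "\<dots> \<longleftrightarrow> (SUP y. ereal (m y)) = ereal lam"
    using SUP_upper[of c UNIV "\<lambda>y. ereal (m y)"] c m_X[OF c(1)] by auto
  finally show ?thesis using PInf mp_index_ext_infinity by simp
next
  case MInf
  have "separates (- \<infinity>) lam \<longleftrightarrow> (\<forall>y. lam \<le> m y)"
    using clamp_in_X m_X by (auto simp: separates_def m_eq) (metis clamp_X)
  also have "\<dots> \<longleftrightarrow> ereal lam \<le> (INF y. ereal (m y))" by (simp add: le_INF_iff)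
  also have "\<dots> \<longleftrightarrow> (INF y. ereal (m y)) = ereal lam"
    using INF_lower[of c UNIV "\<lambda>y. ereal (m y)"] c m_X[OF c(1)] by auto
  finally show ?thesis using MInf mp_index_ext_minus_infinity by simp
qed

lemma no_state_below_iff:
  "(\<forall>x\<in>X. \<not> ereal x \<le> z) \<longleftrightarrow> z \<in> (if lower_end P = - \<infinity> then {- \<infinity>} else {z. z < lower_end P})"
proof (cases "lower_end P")
  case (real l)
  then have "l \<in> X" using ends by (simp add: states_def)
  then show ?thesis using real by (auto simp: states_def not_le intro: less_le_trans)
next
  case MInf
  have "z = - \<infinity>" if no: "\<forall>x\<in>X. \<not> ereal x \<le> z"
  proof (rule ccontr)
    assume "z \<noteq> - \<infinity>"
    \<comment> \<open>The minimum with the upper end ensures that the real number chosen below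
      \<open>z\<close> is also a state.\<close>
    then have "- \<infinity> < min z (upper_end P)" using ends MInf by (auto simp: less_le min_def)
    then obtain y where "ereal y < min z (upper_end P)" using ereal_dense2 by blast
    then have "y \<in> X" "ereal y \<le> z" using MInf by (auto simp: states_def less_imp_le)
    with no show False by blast
  qed
  then show ?thesis using MInf by auto
next
  case PInf
  then show ?thesis using ends by simp
qed

lemma no_state_above_iff:
  "(\<forall>x\<in>X. \<not> z \<le> ereal x) \<longleftrightarrow> z \<in> (if upper_end P = \<infinity> then {\<infinity>} else {z. upper_end P < z})"
proof (cases "upper_end P")
  case (real u)
  then have "u \<in> X" using ends by (simp add: states_def)
  then show ?thesis using real by (auto simp: states_def not_le intro: le_less_trans[of "ereal _" "ereal u"])
next
  case PInf
  have "z = \<infinity>" if no: "\<forall>x\<in>X. \<not> z \<le> ereal x"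
  proof (rule ccontr)
    assume "z \<noteq> \<infinity>"
    then have "max z (lower_end P) < \<infinity>" using ends PInf by (auto simp: less_le max_def)
    then obtain y where "max z (lower_end P) < ereal y" using ereal_dense2 by blast
    then have "y \<in> X" "z \<le> ereal y" using PInf by (auto simp: states_def less_imp_le)
    with no show False by blast
  qed
  then show ?thesis using PInf by auto
next
  case MInf
  then show ?thesis using ends by simp
qed

lemma separates_iff: "separates z lam \<longleftrightarrow> z \<in> inverse_set P lam"
proof -
  consider (eq) c where "c \<in> X" "mp_index P c = lam"
    | (above) "\<forall>x\<in>X. lam < mp_index P x" | (below) "\<forall>x\<in>X. mp_index P x < lam"
    using index_dichotomy by blast
  then show ?thesis
  proof cases
    case eq
    then show ?thesis using separates_iff_mp_index_ext[OF eq] by (auto simp: inverse_set_def)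
  next
    \<comment> \<open>With \<open>lam\<close> below every index value, the second implication always
      holds, while the first can hold only vacuously.\<close>
    case above
    then have "separates z lam \<longleftrightarrow> (\<forall>x\<in>X. \<not> ereal x \<le> z)"
      by (auto simp: separates_def less_imp_le) (meson not_le)
    moreover have "\<not> (\<exists>x\<in>X. mp_index P x = lam)" using above by fastforce
    ultimately show ?thesis using above unfolding no_state_below_iff by (simp add: inverse_set_def)
  next
    case below
    then have "separates z lam \<longleftrightarrow> (\<forall>x\<in>X. \<not> z \<le> ereal x)"
      by (auto simp: separates_def less_imp_le) (meson not_le)
    moreover have not: "\<not> (\<exists>x\<in>X. mp_index P x = lam)" "\<not> (\<forall>x\<in>X. lam < mp_index P x)"
      using below X_not_empty by fastforce+
    ultimately show ?thesis
      unfolding no_state_above_iff inverse_set_def if_not_P[OF not(1)] if_not_P[OF not(2)] if_P[OF below]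
      by simp
  qed
qed

lemma optimal_threshold_map_iff_generalized_inverse:
  "optimal_threshold_map P \<zeta> \<longleftrightarrow> generalized_inverse P \<zeta>"
  by (simp add: optimal_threshold_map_iff generalized_inverse_def separates_iff)

lemma threshold_indexable: "threshold_indexable_with P (mp_index P)"
proof -
  have "\<exists>\<zeta>. \<forall>lam. separates (\<zeta> lam) lam" by (metis threshold_gap)
  then show ?thesis
    by (auto simp: threshold_indexable_with_def thresholdable_def indexable_with_def
        optimal_threshold_map_iff sgn_action_gap)
qed

end

lemma valid_project_bandit:
  assumes "valid_project P"
  obtains w M \<gamma> where "bandit P w M \<gamma>"
proof -
  obtain w M \<gamma> where wM: "w \<in> borel_measurable (state_space P)" "\<And>x. x \<in> states P \<Longrightarrow> 1 \<le> w x"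
    "0 < M" "discount P \<le> \<gamma>" "\<gamma> < 1"
    and bound: "\<And>x a. x \<in> states P \<Longrightarrow> max \<bar>reward P x a\<bar> (consumption P x a) \<le> M * w x"
    and drift: "\<And>x a. x \<in> states P \<Longrightarrow>
      ennreal (discount P) * (\<integral>\<^sup>+ y. ennreal (w y) \<partial>kernel P a x) \<le> ennreal (\<gamma> * w x)"
    using assms unfolding valid_project_def by metis
  interpret weighted_project P w M \<gamma>
    using assms wM drift by unfold_locales (auto simp: valid_project_def)
  \<comment> \<open>Nonnegativity turns the bound on the consumption into one on its absolute value,
    as \<open>weighted\<close> requires.\<close>
  have cons: "0 \<le> consumption P x a" if "x \<in> states P" for x a
    using assms that by (cases a) (auto simp: valid_project_def intro: order_trans less_imp_le)
  have "bandit P w M \<gamma>"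
  proof unfold_locales
    show "stage_weighted M (reward P)" "stage_weighted M (consumption P)"
      using assms bound cons
      by (auto simp: stage_weighted_def weighted_def valid_project_def state_space_def
          intro: borel_measurable_continuous_on_restrict)
  qed
  then show ?thesis by (rule that)
qed

theorem theorem1:
  fixes P :: project
  assumes "valid_project P"
    and "PCLI1 P"
    and "PCLI2 P"
    and "PCLI3 P"
  shows "threshold_indexable_with P (mp_index P) \<and>
         (\<forall>\<zeta>. optimal_threshold_map P \<zeta> \<longleftrightarrow> generalized_inverse P \<zeta>)"
proof -
  obtain w M \<gamma> where "bandit P w M \<gamma>" using valid_project_bandit[OF assms(1)] .
  then interpret pcli_project P w M \<gamma>
    using assms by (intro pcli_project.intro pcli_project_axioms.intro)
  show ?thesis
    using threshold_indexable optimal_threshold_map_iff_generalized_inverse by blast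
qed

end
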